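(* For every $\kappa\in\mathbb{R}$ there exists $N_0=N_0(\kappa)$ such that for all $N\ge N_0$ and all $\epsilon$ with $(\log\log N)^{-1/10}\le \epsilon<1$, $$\frac{p_N(1-\epsilon)}{p_N(\epsilon)}\le 1+(\log\log N)^{-1/10}.$$
   Context: Let $\Sigma_N=\{-1,1\}^N$. For a fixed constant $\kappa\in\mathbb{R}$ and $x\in\Sigma_N$ let $H(x)=\{y\in\Sigma_N: x\cdot y\ge \kappa\sqrt N\}$, where $x\cdot y=\sum_{i=1}^N x^iy^i$. For $p\in[0,1]$, $\mathbb{P}_p$ is the probability measure on $\{0,1\}^{\Sigma_N}$ under which the coordinates $(\omega_x)_{x\in\Sigma_N}$ are independent Bernoulli variables with $\mathbb{P}_p(\omega_x=1)=p$. An intersection over an empty index set is $\Sigma_N$. For $\theta\in(0,1)$ (and $N$ large), $p_N(\theta)$ denotes the value of $p$ such that $\mathbb{P}_{p}\big(\bigcap_{x:\omega_x=1}H(x)=\varnothing\big)=\theta$. *)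

theory Defs
  imports "HOL-Probability.Probability"
begin

definition sign_cube :: "nat \<Rightarrow> (nat \<Rightarrow> real) set" where
  "sign_cube N = {1..N} \<rightarrow>\<^sub>E {-1, 1}"

definition half_cube :: "real \<Rightarrow> nat \<Rightarrow> (nat \<Rightarrow> real) \<Rightarrow> (nat \<Rightarrow> real) set" where
  "half_cube \<kappa> N x = {y \<in> sign_cube N. (\<Sum>i=1..N. x i * y i) \<ge> \<kappa> * sqrt (real N)}"

text \<open>The configuration space \<open>{0,1}\<close> to the power \<open>sign_cube N\<close> is encoded by predicates
  on \<open>nat \<Rightarrow> real\<close> that are \<open>False\<close> outside \<open>sign_cube N\<close>; \<open>\<omega> x\<close> means \<open>\<omega>_x = 1\<close>.\<close>

definition bernoulli_config :: "nat \<Rightarrow> real \<Rightarrow> ((nat \<Rightarrow> real) \<Rightarrow> bool) pmf" where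
  "bernoulli_config N p = Pi_pmf (sign_cube N) False (\<lambda>_. bernoulli_pmf p)"

text \<open>Intersecting with \<open>sign_cube N\<close> implements the convention that the intersection over the
  empty index set is \<open>sign_cube N\<close>, not \<open>UNIV\<close>.\<close>

definition solution_set :: "real \<Rightarrow> nat \<Rightarrow> ((nat \<Rightarrow> real) \<Rightarrow> bool) \<Rightarrow> (nat \<Rightarrow> real) set" where
  "solution_set \<kappa> N \<omega> = sign_cube N \<inter> (\<Inter>x\<in>{x \<in> sign_cube N. \<omega> x}. half_cube \<kappa> N x)"

definition prob_unsat :: "real \<Rightarrow> nat \<Rightarrow> real \<Rightarrow> real" where
  "prob_unsat \<kappa> N p = measure_pmf.prob (bernoulli_config N p) {\<omega>. solution_set \<kappa> N \<omega> = {}}"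

text \<open>For \<open>N > 0\<close> with \<open>sqrt N > - \<kappa>\<close> and \<open>0 < \<theta> < 1\<close> exactly one such \<open>p\<close> exists: \<open>prob_unsat \<kappa> N\<close>
  is a strictly increasing continuous function on \<open>[0,1]\<close> with values 0 at 0 and 1 at 1. For other
  arguments the value need not be meaningful.\<close>

definition crit_prob :: "real \<Rightarrow> nat \<Rightarrow> real \<Rightarrow> real" where
  "crit_prob \<kappa> N \<theta> = (THE p. p \<in> {0..1} \<and> prob_unsat \<kappa> N p = \<theta>)"

end

theory Submission
  imports Defs "HOL-Probability.Hoeffding" "HOL-Real_Asymp.Real_Asymp"
begin

text \<open>
  Let \<open>Z\<close> be the number of solutions. The key estimate is an add-one-constraint bound: if \<open>S\<close> is a
  set of at least \<open>exp (\<eta> * N)\<close> sign vectors, then all but a tiny fraction of the half cubes keep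
  at least \<open>exp (- 3 * s\<^sup>2) * card S\<close> of its points, where \<open>s\<close> is a small power of \<open>N\<close>. It follows
  from a bound on a negative moment of the tilted average of \<open>exp (\<mu> * (x \<bullet> y))\<close> over \<open>y \<in> S\<close>,
  proved by induction on the coordinates. By the Efron--Stein inequality, \<open>max (ln Z) L\<close> is then
  concentrated. Suppose that \<open>p' > (1 + \<delta>) * p\<close> for the parameters \<open>p\<close>, \<open>p'\<close> at which
  unsatisfiability has probability \<open>\<epsilon>\<close> and \<open>1 - \<epsilon>\<close>. At \<open>p\<close> we have \<open>Z = 0\<close> with probability
  \<open>\<epsilon>\<close>, so concentration makes \<open>Z \<ge> exp (2 * L)\<close> unlikely; fewer solutions than that are destroyed
  by the additional constraints between \<open>p\<close> and \<open>p'\<close>, by a first moment bound. So satisfiability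
  has probability less than \<open>\<epsilon>\<close> at \<open>p'\<close>, a contradiction. The choice
  of \<open>L\<close> needs \<open>p * 2 ^ N\<close> to be almost linear in \<open>N\<close>, which follows from the same estimate and
  Russo's formula.
\<close>

section \<open>Product Bernoulli measures on a power set\<close>

text \<open>The expectation of \<open>F\<close> over a random subset of \<open>X\<close> that
  contains each element independently with probability \<open>p\<close>. Written as an explicit
  polynomial, so that identities and derivatives hold for every real \<open>p\<close>.\<close>

definition subset_mean :: "'a set \<Rightarrow> real \<Rightarrow> ('a set \<Rightarrow> real) \<Rightarrow> real" where
  "subset_mean X p F = (\<Sum>A\<in>Pow X. p ^ card A * (1 - p) ^ card (X - A) * F A)"

lemma subset_mean_empty [simp]: "subset_mean {} p F = F {}"
  by (simp add: subset_mean_def)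

text \<open>Conditions on whether the random subset contains \<open>z\<close>; this recursion drives
  the inductions on \<open>X\<close>.\<close>

lemma subset_mean_insert:
  assumes "finite X" "z \<notin> X"
  shows "subset_mean (insert z X) p F =
    p * subset_mean X p (\<lambda>A. F (insert z A)) + (1 - p) * subset_mean X p F"
proof -
  have inj: "inj_on (insert z) (Pow X)" and disj: "Pow X \<inter> insert z ` Pow X = {}"
    using assms by (auto simp: inj_on_def)
  have fin: "finite A" "z \<notin> A" if "A \<in> Pow X" for A
    using that assms by (auto intro: finite_subset)
  have "subset_mean (insert z X) p F =
      (\<Sum>A\<in>Pow X. p ^ card A * (1 - p) ^ card (insert z X - A) * F A) +
      (\<Sum>A\<in>Pow X. p ^ card (insert z A) * (1 - p) ^ card (insert z X - insert z A) * F (insert z A))"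
    unfolding subset_mean_def Pow_insert using assms inj disj
    by (subst sum.union_disjoint) (auto simp: sum.reindex)
  also have "(\<Sum>A\<in>Pow X. p ^ card A * (1 - p) ^ card (insert z X - A) * F A) =
      (1 - p) * subset_mean X p F"
    unfolding subset_mean_def sum_distrib_left
    using fin assms by (intro sum.cong refl) (auto simp: insert_Diff_if)
  also have "(\<Sum>A\<in>Pow X. p ^ card (insert z A) * (1 - p) ^ card (insert z X - insert z A) * F (insert z A))
      = p * subset_mean X p (\<lambda>A. F (insert z A))"
    unfolding subset_mean_def sum_distrib_left
    using fin assms by (intro sum.cong refl) (auto simp: insert_Diff_if)
  finally show ?thesis by simp
qed

lemma subset_mean_add: "subset_mean X p (\<lambda>A. F A + G A) = subset_mean X p F + subset_mean X p G"
  by (simp add: subset_mean_def algebra_simps sum.distrib)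

lemma subset_mean_diff: "subset_mean X p (\<lambda>A. F A - G A) = subset_mean X p F - subset_mean X p G"
  by (simp add: subset_mean_def algebra_simps sum_subtractf)

lemma subset_mean_cmult: "subset_mean X p (\<lambda>A. c * F A) = c * subset_mean X p F"
  by (simp add: subset_mean_def sum_distrib_left algebra_simps)

lemma subset_mean_sum: "subset_mean X p (\<lambda>A. \<Sum>y\<in>S. F y A) = (\<Sum>y\<in>S. subset_mean X p (F y))"
  unfolding subset_mean_def sum_distrib_left by (rule sum.swap)

lemma subset_mean_const [simp]: "finite X \<Longrightarrow> subset_mean X p (\<lambda>A. c) = c"
  by (induction X rule: finite_induct) (auto simp: subset_mean_insert algebra_simps)

lemma subset_mean_cong: "(\<And>A. A \<subseteq> X \<Longrightarrow> F A = G A) \<Longrightarrow> subset_mean X p F = subset_mean X p G"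
  unfolding subset_mean_def by (intro sum.cong) auto

lemma subset_mean_mono:
  assumes "0 \<le> p" "p \<le> 1" "\<And>A. A \<subseteq> X \<Longrightarrow> F A \<le> G A"
  shows "subset_mean X p F \<le> subset_mean X p G"
  unfolding subset_mean_def using assms by (intro sum_mono mult_left_mono) auto

lemma subset_mean_nonneg:
  assumes "0 \<le> p" "p \<le> 1" "\<And>A. A \<subseteq> X \<Longrightarrow> 0 \<le> F A"
  shows "0 \<le> subset_mean X p F"
  unfolding subset_mean_def using assms by (intro sum_nonneg mult_nonneg_nonneg) auto

lemma subset_mean_at_0: "finite X \<Longrightarrow> subset_mean X 0 F = F {}"
  by (induction X rule: finite_induct) (auto simp: subset_mean_insert)

lemma subset_mean_at_1: "finite X \<Longrightarrow> subset_mean X 1 F = F X"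
  by (induction X arbitrary: F rule: finite_induct) (auto simp: subset_mean_insert)

section \<open>Variance and the Efron--Stein inequality\<close>

definition variance_of :: "'a set \<Rightarrow> real \<Rightarrow> ('a set \<Rightarrow> real) \<Rightarrow> real" where
  "variance_of X p F = subset_mean X p (\<lambda>A. (F A - subset_mean X p F)\<^sup>2)"

lemma subset_mean_square_diff:
  assumes "finite X"
  shows "subset_mean X p (\<lambda>A. (F A - c)\<^sup>2) = 
    subset_mean X p (\<lambda>A. (F A)\<^sup>2) - 2 * c * subset_mean X p F + c\<^sup>2"
proof -
  have "subset_mean X p (\<lambda>A. (F A - c)\<^sup>2) = subset_mean X p (\<lambda>A. ((F A)\<^sup>2 - 2 * c * F A) + c\<^sup>2)"
    by (simp add: power2_diff algebra_simps)
  then show ?thesis using assms by (simp add: subset_mean_add subset_mean_diff subset_mean_cmult)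
qed

lemma subset_mean_square_le:
  assumes "finite X" "0 \<le> p" "p \<le> 1"
  shows "(subset_mean X p F)\<^sup>2 \<le> subset_mean X p (\<lambda>A. (F A)\<^sup>2)"
proof -
  have "0 \<le> subset_mean X p (\<lambda>A. (F A - subset_mean X p F)\<^sup>2)"
    using assms by (intro subset_mean_nonneg) auto
  then show ?thesis
    unfolding subset_mean_square_diff[OF assms(1)] by (simp add: power2_eq_square)
qed

lemma variance_of_alt:
  assumes "finite X"
  shows "variance_of X p F = subset_mean X p (\<lambda>A. (F A)\<^sup>2) - (subset_mean X p F)\<^sup>2"
  unfolding variance_of_def subset_mean_square_diff[OF assms] by (simp add: power2_eq_square)

text \<open>The common recursion for the sums in Efron--Stein (\<open>h s t = (t - s)^2\<close>) and
  in Russo's formula (\<open>h s t = t - s\<close>). Elements of \<open>A\<close> contribute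
  nothing, so \<open>z\<close> adds its own term only when it is absent, which has probability
  \<open>1 - p\<close>.\<close>

lemma subset_mean_increments_insert:
  assumes "finite X" "z \<notin> X"
  shows "subset_mean (insert z X) p (\<lambda>A. \<Sum>x\<in>insert z X - A. h (F A) (F (insert x A))) =
    (1 - p) * subset_mean X p (\<lambda>A. h (F A) (F (insert z A)) :: real)
    + p * subset_mean X p (\<lambda>A. \<Sum>x\<in>X - A. h (F (insert z A)) (F (insert z (insert x A))))
    + (1 - p) * subset_mean X p (\<lambda>A. \<Sum>x\<in>X - A. h (F A) (F (insert x A)))"
proof -
  have 1: "(\<Sum>x\<in>insert z X - insert z A. h (F (insert z A)) (F (insert x (insert z A)))) =
      (\<Sum>x\<in>X - A. h (F (insert z A)) (F (insert z (insert x A))))" if "A \<subseteq> X" for A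
    using assms that by (intro sum.cong) (auto simp: insert_commute)
  have 2: "(\<Sum>x\<in>insert z X - A. h (F A) (F (insert x A))) =
      h (F A) (F (insert z A)) + (\<Sum>x\<in>X - A. h (F A) (F (insert x A)))" if "A \<subseteq> X" for A
  proof -
    have "insert z X - A = insert z (X - A)" "z \<notin> X - A" "finite (X - A)"
      using assms that by auto
    then show ?thesis by simp
  qed
  have 1: "subset_mean X p (\<lambda>A. \<Sum>x\<in>insert z X - insert z A. h (F (insert z A)) (F (insert x (insert z A)))) =
      subset_mean X p (\<lambda>A. \<Sum>x\<in>X - A. h (F (insert z A)) (F (insert z (insert x A))))"
    by (rule subset_mean_cong) (rule 1)
  have 2: "subset_mean X p (\<lambda>A. \<Sum>x\<in>insert z X - A. h (F A) (F (insert x A))) =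
      subset_mean X p (\<lambda>A. h (F A) (F (insert z A)))
      + subset_mean X p (\<lambda>A. \<Sum>x\<in>X - A. h (F A) (F (insert x A)))"
    unfolding subset_mean_add[symmetric] by (rule subset_mean_cong) (rule 2)
  show ?thesis
    unfolding subset_mean_insert[OF assms] 1 2 by (simp add: algebra_simps)
qed

text \<open>Induction by the law of total variance: conditioning on \<open>z\<close> leaves the two
  conditional variances and \<open>p * (1 - p)\<close> times the squared gap of the conditional
  means. The usual factor \<open>1 - p\<close> is absorbed by summing only over elements outside
  \<open>A\<close>.\<close>

lemma efron_stein:
  assumes "finite X" "0 \<le> p" "p \<le> 1"
  shows "variance_of X p F \<le> p * subset_mean X p (\<lambda>A. \<Sum>x\<in>X - A. (F (insert x A) - F A)\<^sup>2)"
  using assms(1)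
proof (induction X arbitrary: F rule: finite_induct)
  case empty
  then show ?case by (simp add: variance_of_def)
next
  case (insert z X)
  let ?F1 = "\<lambda>A. F (insert z A)"
  let ?M = "subset_mean X p"
  define a where "a = ?M ?F1"
  define b where "b = ?M F"
  have fin: "finite (insert z X)" using insert by simp
  have v1: "variance_of X p ?F1 = ?M (\<lambda>A. (?F1 A)\<^sup>2) - a\<^sup>2"
    and v0: "variance_of X p F = ?M (\<lambda>A. (F A)\<^sup>2) - b\<^sup>2"
    unfolding a_def b_def using insert by (simp_all add: variance_of_alt)
  have v: "variance_of (insert z X) p F =
      p * ?M (\<lambda>A. (?F1 A)\<^sup>2) + (1 - p) * ?M (\<lambda>A. (F A)\<^sup>2) - (p * a + (1 - p) * b)\<^sup>2"
    unfolding variance_of_alt[OF fin] a_def b_def using insert by (simp add: subset_mean_insert)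
  have "p * s + (1 - p) * t - (p * a + (1 - p) * b)\<^sup>2 =
      p * (s - a\<^sup>2) + (1 - p) * (t - b\<^sup>2) + p * (1 - p) * (a - b)\<^sup>2" for s t
    by algebra
  then have split: "variance_of (insert z X) p F =
      p * variance_of X p ?F1 + (1 - p) * variance_of X p F + p * (1 - p) * (a - b)\<^sup>2"
    unfolding v v1 v0 .
  have eq: "p * ((1 - p) * u + p * v + (1 - p) * w) =
      p * (1 - p) * u + p * (p * v) + (1 - p) * (p * w)" for u v w
    by algebra
  \<comment> \<open>Jensen's inequality bounds the squared gap of the conditional means by the mean
    squared effect of adding \<open>z\<close>.\<close>
  have "(a - b)\<^sup>2 = (?M (\<lambda>A. ?F1 A - F A))\<^sup>2"
    by (simp add: a_def b_def subset_mean_diff)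
  also have "\<dots> \<le> ?M (\<lambda>A. (?F1 A - F A)\<^sup>2)"
    using insert assms by (intro subset_mean_square_le) auto
  finally have "p * (1 - p) * (a - b)\<^sup>2 \<le> p * (1 - p) * ?M (\<lambda>A. (?F1 A - F A)\<^sup>2)"
    using assms by (intro mult_left_mono) auto
  moreover have "p * variance_of X p ?F1 \<le>
      p * (p * ?M (\<lambda>A. \<Sum>x\<in>X - A. (?F1 (insert x A) - ?F1 A)\<^sup>2))"
    using insert.IH[of ?F1] assms by (intro mult_left_mono) auto
  moreover have "(1 - p) * variance_of X p F \<le>
      (1 - p) * (p * ?M (\<lambda>A. \<Sum>x\<in>X - A. (F (insert x A) - F A)\<^sup>2))"
    using insert.IH[of F] assms by (intro mult_left_mono) auto
  ultimately show ?case
    unfolding split subset_mean_increments_insert[OF insert(1,2), of p "\<lambda>s t. (t - s)\<^sup>2" F] eq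
    by linarith
qed

text \<open>Russo's formula, with the factor \<open>1 - p\<close> moved to the other side so that only constraints
  outside \<open>A\<close> are added and no independence argument is needed.\<close>

lemma subset_mean_has_derivative:
  assumes "finite X"
  shows "\<exists>D. ((\<lambda>p. subset_mean X p F) has_real_derivative D) (at p) \<and>
    (1 - p) * D = subset_mean X p (\<lambda>A. \<Sum>x\<in>X - A. F (insert x A) - F A)"
  using assms
proof (induction X arbitrary: F rule: finite_induct)
  case empty
  then show ?case by (intro exI[of _ 0]) (auto intro!: derivative_eq_intros)
next
  case (insert z X)
  have mixture: "((\<lambda>p. p * f p + (1 - p) * g p) has_real_derivative
      f p - g p + p * D1 + (1 - p) * D0) (at p)"
    if "(f has_real_derivative D1) (at p)" "(g has_real_derivative D0) (at p)"
    for f g :: "real \<Rightarrow> real" and D1 D0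
    using that by (auto intro!: derivative_eq_intros)
  let ?F1 = "\<lambda>A. F (insert z A)"
  obtain D0 where D0: "((\<lambda>p. subset_mean X p F) has_real_derivative D0) (at p)"
    "(1 - p) * D0 = subset_mean X p (\<lambda>A. \<Sum>x\<in>X - A. F (insert x A) - F A)"
    using insert.IH[of F] by blast
  obtain D1 where D1: "((\<lambda>p. subset_mean X p ?F1) has_real_derivative D1) (at p)"
    "(1 - p) * D1 = subset_mean X p (\<lambda>A. \<Sum>x\<in>X - A. ?F1 (insert x A) - ?F1 A)"
    using insert.IH[of ?F1] by blast
  let ?D = "subset_mean X p ?F1 - subset_mean X p F + p * D1 + (1 - p) * D0"
  have "((\<lambda>p. subset_mean (insert z X) p F) has_real_derivative ?D) (at p)"
    unfolding subset_mean_insert[OF insert(1,2)]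
    by (rule mixture D0 D1)+
  moreover have "(1 - p) * (s - t + p * D1 + (1 - p) * D0) =
      (1 - p) * (s - t) + p * ((1 - p) * D1) + (1 - p) * ((1 - p) * D0)" for s t
    by algebra
  then have "(1 - p) * ?D =
      (1 - p) * subset_mean X p (\<lambda>A. ?F1 A - F A) + p * ((1 - p) * D1) + (1 - p) * ((1 - p) * D0)"
    unfolding subset_mean_diff .
  ultimately show ?case
    unfolding D0 D1 subset_mean_increments_insert[OF insert(1,2), of p "\<lambda>s t. t - s" F] by blast
qed

text \<open>The union of independent random subsets of densities \<open>p\<close> and
  \<open>r\<close> misses an element with probability \<open>(1 - p) * (1 - r)\<close>. A larger
  density is thereby an old configuration plus fresh independent constraints.\<close>

lemma subset_mean_sprinkle:
  assumes "finite X"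
  shows "subset_mean X p (\<lambda>A. subset_mean X r (\<lambda>B. F (A \<union> B))) =
    subset_mean X (1 - (1 - p) * (1 - r)) F"
  using assms
proof (induction X arbitrary: F rule: finite_induct)
  case empty
  then show ?case by simp
next
  case (insert z X)
  have eq: "p * (r * s + (1 - r) * s) + (1 - p) * (r * s + (1 - r) * t) =
      (1 - (1 - p) * (1 - r)) * s + (1 - (1 - (1 - p) * (1 - r))) * t" for s t
    by algebra
  let ?I = "\<lambda>F. subset_mean X p (\<lambda>A. subset_mean X r (\<lambda>B. F (A \<union> B)))"
  let ?F1 = "\<lambda>A. F (insert z A)"
  have "subset_mean (insert z X) p (\<lambda>A. subset_mean (insert z X) r (\<lambda>B. F (A \<union> B))) =
    p * subset_mean X p (\<lambda>A. r * subset_mean X r (\<lambda>B. F (insert z (A \<union> B)))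
      + (1 - r) * subset_mean X r (\<lambda>B. F (insert z (A \<union> B))))
    + (1 - p) * subset_mean X p (\<lambda>A. r * subset_mean X r (\<lambda>B. F (insert z (A \<union> B)))
      + (1 - r) * subset_mean X r (\<lambda>B. F (A \<union> B)))"
    unfolding subset_mean_insert[OF insert(1,2)] by simp
  also have "\<dots> = p * (r * ?I ?F1 + (1 - r) * ?I ?F1) + (1 - p) * (r * ?I ?F1 + (1 - r) * ?I F)"
    unfolding subset_mean_add subset_mean_cmult ..
  also have "\<dots> = (1 - (1 - p) * (1 - r)) * ?I ?F1 + (1 - (1 - (1 - p) * (1 - r))) * ?I F"
    by (rule eq)
  finally show ?case
    unfolding insert.IH[of F] insert.IH[of ?F1] subset_mean_insert[OF insert(1,2)] .
qed

lemma subset_mean_disjoint: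
  assumes "finite X" "C \<subseteq> X"
  shows "subset_mean X p (\<lambda>A. of_bool (A \<inter> C = {})) = (1 - p) ^ card C"
  using assms
proof (induction X arbitrary: C rule: finite_induct)
  case empty
  then show ?case by simp
next
  case (insert z X)
  show ?case
  proof (cases "z \<in> C")
    case True
    have *: "of_bool (A \<inter> C = {}) = (of_bool (A \<inter> (C - {z}) = {}) :: real)" if "A \<subseteq> X" for A
      using that insert by auto
    have C: "C - {z} \<subseteq> X" "finite C" using insert by (auto intro: finite_subset)
    have card: "card C = Suc (card (C - {z}))"
      using card_Suc_Diff1[OF C(2) True] by simp
    have 1: "subset_mean X p (\<lambda>A. of_bool (insert z A \<inter> C = {})) = 0"
      using True insert.hyps by simp
    have 2: "subset_mean X p (\<lambda>A. of_bool (A \<inter> C = {})) = (1 - p) ^ card (C - {z})"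
      unfolding insert.IH[OF C(1), symmetric] by (rule subset_mean_cong) (rule *)
    show ?thesis
      unfolding subset_mean_insert[OF insert(1,2)] 1 2 card by simp
  next
    case False
    then have "C \<subseteq> X" using insert by auto
    then show ?thesis using False insert.IH[of C] insert.hyps
      by (simp add: subset_mean_insert algebra_simps)
  qed
qed

lemma subset_mean_chebyshev:
  assumes "finite X" "0 \<le> p" "p \<le> 1" "t > 0"
  shows "subset_mean X p (\<lambda>A. of_bool (t \<le> \<bar>F A - subset_mean X p F\<bar>)) \<le> variance_of X p F / t\<^sup>2"
proof -
  have "t\<^sup>2 * subset_mean X p (\<lambda>A. of_bool (t \<le> \<bar>F A - subset_mean X p F\<bar>)) \<le> variance_of X p F"
    unfolding variance_of_def subset_mean_cmult[symmetric]
  proof (intro subset_mean_mono assms)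
    fix A
    show "t\<^sup>2 * of_bool (t \<le> \<bar>F A - subset_mean X p F\<bar>) \<le> (F A - subset_mean X p F)\<^sup>2"
    proof (cases "t \<le> \<bar>F A - subset_mean X p F\<bar>")
      case True
      then have "t\<^sup>2 \<le> \<bar>F A - subset_mean X p F\<bar>\<^sup>2"
        using assms(4) by (intro power_mono) auto
      with True show ?thesis by simp
    qed simp
  qed
  then show ?thesis using assms by (simp add: field_simps)
qed

text \<open>Transfers events of the product measure to \<open>subset_mean\<close>: almost surely a
  configuration is the indicator of a subset of \<open>X\<close>, and its mass is the corresponding
  Bernoulli weight.\<close>

lemma Pi_pmf_bernoulli_prob:
  assumes "finite X" "0 \<le> p" "p \<le> 1"
  shows "measure_pmf.prob (Pi_pmf X False (\<lambda>_. bernoulli_pmf p)) {\<omega>. Q {x \<in> X. \<omega> x}} =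
    subset_mean X p (\<lambda>A. of_bool (Q A))"
proof -
  let ?P = "Pi_pmf X False (\<lambda>_. bernoulli_pmf p)"
  let ?E = "{\<omega>. Q {x \<in> X. \<omega> x}}"
  let ?W = "(\<lambda>A x. x \<in> A) ` {A \<in> Pow X. Q A}"
  have sub: "set_pmf ?P \<subseteq> {\<omega>. \<forall>x. \<omega> x \<longrightarrow> x \<in> X}"
    using set_Pi_pmf_subset[OF assms(1), of False "\<lambda>_. bernoulli_pmf p"] by auto
  \<comment> \<open>The events are compared on the support only: elsewhere a configuration could be
    true outside \<open>X\<close>.\<close>
  have "?E \<inter> set_pmf ?P = ?W \<inter> set_pmf ?P"
  proof (intro equalityI subsetI)
    fix \<omega> assume w: "\<omega> \<in> ?E \<inter> set_pmf ?P"
    then have "\<omega> = (\<lambda>x. x \<in> {x \<in> X. \<omega> x})" using sub by auto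
    with w show "\<omega> \<in> ?W \<inter> set_pmf ?P" by blast
  next
    fix \<omega> assume "\<omega> \<in> ?W \<inter> set_pmf ?P"
    then obtain A where A: "A \<subseteq> X" "Q A" "\<omega> = (\<lambda>x. x \<in> A)" "\<omega> \<in> set_pmf ?P" by blast
    then have "{x \<in> X. \<omega> x} = A" by auto
    with A show "\<omega> \<in> ?E \<inter> set_pmf ?P" by auto
  qed
  then have "measure_pmf.prob ?P ?E = measure_pmf.prob ?P ?W"
    using measure_Int_set_pmf[of ?P ?E] measure_Int_set_pmf[of ?P ?W] by simp
  also have "\<dots> = sum (pmf ?P) ?W"
    using assms by (intro measure_measure_pmf_finite) auto
  also have "\<dots> = (\<Sum>A\<in>{A \<in> Pow X. Q A}. pmf ?P (\<lambda>x. x \<in> A))"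
    by (subst sum.reindex) (auto simp: inj_on_def fun_eq_iff)
  also have "\<dots> = (\<Sum>A\<in>{A \<in> Pow X. Q A}. p ^ card A * (1 - p) ^ card (X - A))"
  proof (intro sum.cong refl)
    fix A assume A: "A \<in> {A \<in> Pow X. Q A}"
    have "pmf ?P (\<lambda>x. x \<in> A) = (\<Prod>x\<in>X. pmf (bernoulli_pmf p) (x \<in> A))"
      using A assms by (subst pmf_Pi') auto
    also have "\<dots> = (\<Prod>x\<in>X. if x \<in> A then p else 1 - p)"
      using assms by (intro prod.cong) auto
    also have "\<dots> = p ^ card (X \<inter> A) * (1 - p) ^ card (X \<inter> - A)"
      using assms(1) by (subst prod.If_cases) auto
    also have "X \<inter> A = A" using A by auto
    also have "X \<inter> - A = X - A" by auto
    finally show "pmf ?P (\<lambda>x. x \<in> A) = p ^ card A * (1 - p) ^ card (X - A)" .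
  qed
  also have "\<dots> = subset_mean X p (\<lambda>A. of_bool (Q A))"
    unfolding subset_mean_def using assms(1)
    by (intro sum.mono_neutral_cong_left) auto
  finally show ?thesis .
qed

section \<open>Elementary inequalities\<close>

lemma sum_signs_insert:
  fixes f :: "('a \<Rightarrow> real) \<Rightarrow> 'b :: comm_monoid_add"
  assumes "finite I" "i \<notin> I"
  shows "(\<Sum>x\<in>insert i I \<rightarrow>\<^sub>E {-1, 1}. f x) = (\<Sum>x\<in>I \<rightarrow>\<^sub>E {-1, 1}. f (x(i := 1)) + f (x(i := -1)))"
proof -
  have inj: "inj_on (\<lambda>(y, g). g(i := y)) ({-1, 1::real} \<times> (I \<rightarrow>\<^sub>E {-1, 1}))"
    using inj_combinator[OF assms(2), of "\<lambda>_. {-1, 1}"] .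
  have "(\<Sum>x\<in>insert i I \<rightarrow>\<^sub>E {-1, 1}. f x) =
      (\<Sum>(s, x)\<in>{-1, 1} \<times> (I \<rightarrow>\<^sub>E {-1, 1}). f (x(i := s)))"
    unfolding PiE_insert_eq using inj by (subst sum.reindex) (auto simp: case_prod_unfold)
  also have "\<dots> = (\<Sum>s\<in>{-1, 1}. \<Sum>x\<in>I \<rightarrow>\<^sub>E {-1, 1}. f (x(i := s)))"
    by (rule sum.cartesian_product[symmetric])
  finally show ?thesis by (simp add: sum.distrib add.commute)
qed

lemma inner_fun_upd:
  fixes x y :: "'a \<Rightarrow> real"
  assumes "finite I" "i \<notin> I"
  shows "(\<Sum>j\<in>insert i I. (x(i := s)) j * y j) = s * y i + (\<Sum>j\<in>I. x j * y j)"
proof -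
  have "(\<Sum>j\<in>I. (x(i := s)) j * y j) = (\<Sum>j\<in>I. x j * y j)"
    using assms by (intro sum.cong) auto
  then show ?thesis using assms by simp
qed

text \<open>Hoeffding's lemma for a fair sign: the auxiliary bound at \<open>2 * t\<close> with
  weight \<open>1 / 2\<close>. Both sides are even, so nonnegative arguments suffice.\<close>

lemma cosh_le_exp_half_square: "cosh (x::real) \<le> exp (x\<^sup>2 / 2)"
proof -
  have pos: "cosh t \<le> exp (t\<^sup>2 / 2)" if "0 \<le> t" for t :: real
  proof -
    have "1 + 1 / 2 * (exp (2 * t) - 1) = exp t * cosh t"
      by (simp add: cosh_def field_simps exp_add[symmetric])
    then have "- t + ln (exp t * cosh t) \<le> t\<^sup>2 / 2"
      using Hoeffdings_lemma_aux[of "2 * t" "1 / 2"] that by (simp add: power2_eq_square)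
    then have "ln (cosh t) \<le> t\<^sup>2 / 2"
      using cosh_real_pos[of t] by (simp add: ln_mult)
    then show ?thesis using cosh_real_pos[of t] by (metis exp_le_cancel_iff exp_ln)
  qed
  show ?thesis using pos[of x] pos[of "-x"] by (cases "0 \<le> x") auto
qed

text \<open>The product of \<open>1 + t + t^2 / 2\<close> and \<open>1 - t + t^2 / 2\<close> is
  \<open>1 + t^4 / 4\<close>, so the Taylor lower bound on \<open>exp t\<close> yields the upper
  bound \<open>1 - t + t^2 / 2\<close> on \<open>exp (- t)\<close>.\<close>

lemma exp_minus_exp_uminus_ge:
  fixes t :: real
  assumes "0 \<le> t"
  shows "2 * t \<le> exp t - exp (- t)"
proof -
  have ge: "1 + t + t\<^sup>2 / 2 \<le> exp t" using exp_lower_Taylor_quadratic[OF assms] by simp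
  have "(1 + t + t\<^sup>2 / 2) * (1 - t + t\<^sup>2 / 2) = 1 + (t\<^sup>2)\<^sup>2 / 4"
    by (simp add: algebra_simps power2_eq_square)
  then have "1 \<le> (1 + t + t\<^sup>2 / 2) * (1 - t + t\<^sup>2 / 2)" by simp
  also have "\<dots> \<le> exp t * (1 - t + t\<^sup>2 / 2)"
  proof (intro mult_right_mono ge)
    have eq: "1 - t + t\<^sup>2 / 2 = ((1 - t)\<^sup>2 + 1) / 2" by (simp add: power2_eq_square algebra_simps)
    show "0 \<le> 1 - t + t\<^sup>2 / 2" unfolding eq by simp
  qed
  finally have "exp (- t) \<le> 1 - t + t\<^sup>2 / 2" by (simp add: exp_minus field_simps)
  then show ?thesis using ge by linarith
qed

text \<open>The preceding bound at \<open>t / 2\<close>, squared, because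
  \<open>2 * cosh t - 2 = (exp (t / 2) - exp (- (t / 2)))^2\<close>.\<close>

lemma one_plus_le_cosh:
  fixes t :: real
  shows "1 + t\<^sup>2 / 2 \<le> cosh t"
proof -
  have pos: "1 + t\<^sup>2 / 2 \<le> cosh t" if "0 \<le> t" for t :: real
  proof -
    have "t\<^sup>2 \<le> (exp (t / 2) - exp (- (t / 2)))\<^sup>2"
      using exp_minus_exp_uminus_ge[of "t / 2"] that by (intro power_mono) auto
    also have "\<dots> = 2 * cosh t - 2"
      by (simp add: power2_diff cosh_def exp_add[symmetric] power2_eq_square field_simps exp_minus)
    finally show ?thesis by simp
  qed
  show ?thesis using pos[of t] pos[of "-t"] by (cases "0 \<le> t") auto
qed

lemma exp_half_le_one_plus:
  fixes t :: real
  assumes "0 \<le> t" "t \<le> 1"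
  shows "exp (t / 2) \<le> 1 + t"
proof -
  have "t * t \<le> 1 * t" using assms by (intro mult_right_mono) auto
  then show ?thesis
    using exp_bound[of "t / 2"] assms by (simp add: power2_eq_square)
qed

text \<open>Convexity of a negative power: \<open>ln\<close> is concave, multiplication by
  \<open>- b\<close> reverses the inequality, and \<open>exp\<close> is convex.\<close>

lemma powr_uminus_convex:
  fixes P Q w b :: real
  assumes "0 < P" "0 < Q" "0 \<le> w" "w \<le> 1" "0 \<le> b"
  shows "(w * P + (1 - w) * Q) powr (- b) \<le> w * P powr (- b) + (1 - w) * Q powr (- b)"
proof -
  have pos: "0 < w * P + (1 - w) * Q"
    using assms by (cases "w = 0") (auto intro: add_pos_nonneg)
  have "w * ln P + (1 - w) * ln Q \<le> ln (w * P + (1 - w) * Q)"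
    using concave_onD[OF ln_concave, of "1 - w" P Q] assms by simp
  then have "- b * ln (w * P + (1 - w) * Q) \<le> - b * (w * ln P + (1 - w) * ln Q)"
    using assms by (intro mult_left_mono_neg) auto
  then have "exp (- b * ln (w * P + (1 - w) * Q)) \<le> exp (w * (- b * ln P) + (1 - w) * (- b * ln Q))"
    by (simp add: algebra_simps)
  also have "\<dots> \<le> w * exp (- b * ln P) + (1 - w) * exp (- b * ln Q)"
    using convex_onD[OF exp_convex, of "1 - w" "- b * ln P" "- b * ln Q"] assms by simp
  finally show ?thesis using assms pos by (simp add: powr_def)
qed

text \<open>Convexity in the exponent: \<open>1 - a\<close> is the mean of \<open>1\<close> and
  \<open>1 / 2\<close> with weights \<open>1 - 2 * a\<close> and \<open>2 * a\<close>.\<close>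

lemma powr_one_minus_le:
  fixes t a :: real
  assumes "0 < t" "0 \<le> a" "a \<le> 1 / 2"
  shows "t powr (1 - a) \<le> t + 2 * a * (sqrt t - t)"
proof -
  have "t powr (1 - a) = exp ((1 - 2 * a) * ln t + 2 * a * (ln t / 2))"
    using assms by (simp add: powr_def algebra_simps)
  also have "\<dots> \<le> (1 - 2 * a) * exp (ln t) + 2 * a * exp (ln t / 2)"
    using convex_onD[OF exp_convex, of "2 * a" "ln t" "ln t / 2"] assms by simp
  also have "exp (ln t / 2) = sqrt t"
    using assms by (simp add: powr_half_sqrt[symmetric] powr_def)
  finally show ?thesis using assms by (simp add: algebra_simps)
qed

text \<open>For \<open>w \<le> 1 / 2\<close>, AM-GM gives
  \<open>sqrt w \<le> \<theta> + w / (4 * \<theta>)\<close>, and \<open>1 - w \<ge> 1 / 2\<close>;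
  symmetry covers the other half. The free \<open>\<theta>\<close> trades the constant term against
  the coefficient of \<open>w * (1 - w)\<close>.\<close>

lemma sqrt_sum_le:
  fixes w \<theta> :: real
  assumes "0 \<le> w" "w \<le> 1" "0 < \<theta>"
  shows "sqrt w + sqrt (1 - w) - 1 \<le> \<theta> + w * (1 - w) / (2 * \<theta>)"
proof -
  have half: "sqrt v + sqrt (1 - v) - 1 \<le> \<theta> + v * (1 - v) / (2 * \<theta>)" if v: "0 \<le> v" "v \<le> 1 / 2" for v
  proof -
    have "0 \<le> (2 * \<theta> - sqrt v)\<^sup>2" by simp
    then have "4 * \<theta> * sqrt v \<le> 4 * \<theta>\<^sup>2 + v"
      using v by (simp add: power2_diff power_mult_distrib)
    then have "sqrt v \<le> \<theta> + v / (4 * \<theta>)"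
      using assms(3) by (simp add: field_simps power2_eq_square)
    also have "v / (4 * \<theta>) \<le> v * (1 - v) / (2 * \<theta>)"
    proof -
      have "v * (1 / 2) \<le> v * (1 - v)" using v by (intro mult_left_mono) auto
      then show ?thesis using assms(3) by (simp add: field_simps)
    qed
    finally have "sqrt v \<le> \<theta> + v * (1 - v) / (2 * \<theta>)" by simp
    moreover have "sqrt (1 - v) \<le> 1" using v by simp
    ultimately show ?thesis by linarith
  qed
  show ?thesis
    using half[of w] half[of "1 - w"] assms by (cases "w \<le> 1 / 2") (auto simp: algebra_simps)
qed

text \<open>The induction step of \<open>negative_moment_bound\<close>: \<open>w\<close> is the fraction of points with
  coordinate 1, and the exponent \<open>a\<close> is chosen so that the terms in \<open>w * (1 - w)\<close> cancel.\<close>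

lemma tilted_weights_le:
  fixes w \<mu> a b \<theta> :: real
  assumes w: "0 < w" "w < 1" and \<mu>: "0 \<le> \<mu>" "\<mu> \<le> 1 / 2"
    and b: "0 \<le> b" "b \<le> 1" and \<theta>: "0 < \<theta>" "\<theta> \<le> 1" and a: "a = \<theta> * b * \<mu>\<^sup>2 / 3"
    and cp: "cp = w * exp \<mu> + (1 - w) * exp (- \<mu>)"
    and cm: "cm = w * exp (- \<mu>) + (1 - w) * exp \<mu>"
  shows "cp powr (- b) * (w * exp \<mu> / cp * w powr (- a) + (1 - w) * exp (- \<mu>) / cp * (1 - w) powr (- a))
    + cm powr (- b) * (w * exp (- \<mu>) / cm * w powr (- a) + (1 - w) * exp \<mu> / cm * (1 - w) powr (- a))
    \<le> 2 * exp (b\<^sup>2 * \<mu>\<^sup>2 / 2 + 2 * \<theta>\<^sup>2 * b * \<mu>\<^sup>2)"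
proof -
  have \<mu>2: "\<mu>\<^sup>2 \<le> 1 / 4" using power_mono[OF \<mu>(2,1), of 2] by (simp add: power2_eq_square)
  have "\<theta> * b * \<mu>\<^sup>2 \<le> 1 * 1 * (1 / 4)"
    using \<mu>2 b \<theta> by (intro mult_mono) auto
  then have a01: "0 \<le> a" "a \<le> 1 / 2" unfolding a using b \<theta> by auto
  have em: "exp (- \<mu>) \<le> exp \<mu>" using \<mu> by simp
  have bounds: "exp (- \<mu>) \<le> c" "c \<le> exp \<mu>"
    if "c = v * exp \<mu> + (1 - v) * exp (- \<mu>)" "0 < v" "v < 1" for c v
  proof -
    have "c = exp (- \<mu>) + v * (exp \<mu> - exp (- \<mu>))" "c = exp \<mu> - (1 - v) * (exp \<mu> - exp (- \<mu>))"
      unfolding that by (simp_all add: algebra_simps)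
    moreover have "0 \<le> v * (exp \<mu> - exp (- \<mu>))" "0 \<le> (1 - v) * (exp \<mu> - exp (- \<mu>))"
      using that em by auto
    ultimately show "exp (- \<mu>) \<le> c" "c \<le> exp \<mu>" by linarith+
  qed
  have cpb: "exp (- \<mu>) \<le> cp" "cp \<le> exp \<mu>" using bounds[OF cp] w by auto
  have cmb: "exp (- \<mu>) \<le> cm" "cm \<le> exp \<mu>" using bounds[of cm "1 - w"] cm w by auto
  have pos: "0 < cp" "0 < cm" using cpb cmb exp_gt_zero[of "- \<mu>"] by linarith+
  have e3: "exp (2 * \<mu>) \<le> 3"
  proof -
    have "exp (2 * \<mu>) \<le> exp 1" using \<mu> by simp
    then show ?thesis using exp_le by linarith
  qed
  have ratio: "u * exp s / c \<le> 3 * u" if "exp (- \<mu>) \<le> c" "s \<le> \<mu>" "0 \<le> u" for u s c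
  proof -
    have c: "0 < c" using that exp_gt_zero[of "- \<mu>"] by linarith
    have "exp s \<le> exp \<mu>" using that by simp
    also have "\<dots> = exp (2 * \<mu>) * exp (- \<mu>)" by (simp add: exp_add[symmetric])
    also have "\<dots> \<le> 3 * c" using e3 that c by (intro mult_mono) auto
    finally have "u * exp s \<le> u * (3 * c)" using that by (intro mult_left_mono) auto
    then show ?thesis using c by (simp add: field_simps)
  qed
  \<comment> \<open>\<open>G\<close> will bound both tilted averages of \<open>w powr (- a)\<close>
    and \<open>(1 - w) powr (- a)\<close>. Tilting multiplies each weight by at most 3 but keeps the
    total mass 1, so only the excess over 1 is tripled.\<close>
  define G where "G = 1 + 3 * (w powr (1 - a) - w + ((1 - w) powr (1 - a) - (1 - w)))"
  have powr_ge: "1 \<le> t powr (- a)" if "0 < t" "t \<le> 1" for t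
    using powr_mono'[of "- a" 0 t] that a01 by simp
  have tiltG: "p * w powr (- a) + q * (1 - w) powr (- a) \<le> G"
    if "p + q = 1" "p \<le> 3 * w" "q \<le> 3 * (1 - w)" for p q
  proof -
    have "p * (w powr (- a) - 1) \<le> 3 * w * (w powr (- a) - 1)"
      "q * ((1 - w) powr (- a) - 1) \<le> 3 * (1 - w) * ((1 - w) powr (- a) - 1)"
      using that powr_ge[of w] powr_ge[of "1 - w"] w by (auto intro!: mult_right_mono)
    moreover have "w * w powr (- a) = w powr (1 - a)" "(1 - w) * (1 - w) powr (- a) = (1 - w) powr (1 - a)"
      using w by (simp_all add: powr_mult_base)
    ultimately show ?thesis using that(1) unfolding G_def by (simp add: algebra_simps)
  qed
  have "w powr (1 - a) - w + ((1 - w) powr (1 - a) - (1 - w)) \<le> 2 * a * (sqrt w + sqrt (1 - w) - 1)"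
    using powr_one_minus_le[of w a] powr_one_minus_le[of "1 - w" a] a01 w by (simp add: algebra_simps)
  also have "\<dots> \<le> 2 * a * (\<theta> + w * (1 - w) / (2 * \<theta>))"
    using sqrt_sum_le[of w \<theta>] w \<theta> a01 by (intro mult_left_mono) auto
  finally have "G \<le> 1 + 3 * (2 * a * (\<theta> + w * (1 - w) / (2 * \<theta>)))"
    unfolding G_def by simp
  \<comment> \<open>The value of \<open>a\<close> turns the coefficient
    \<open>3 * a / \<theta>\<close> of \<open>w * (1 - w)\<close> into
    \<open>b * \<mu>^2\<close>.\<close>
  also have "\<dots> = 1 + (2 * \<theta>\<^sup>2 * b * \<mu>\<^sup>2 + b * \<mu>\<^sup>2 * (w * (1 - w)))"
    unfolding a using \<theta> by (simp add: field_simps power2_eq_square)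
  also have "\<dots> \<le> exp (2 * \<theta>\<^sup>2 * b * \<mu>\<^sup>2 + b * \<mu>\<^sup>2 * (w * (1 - w)))"
    by (rule exp_ge_add_one_self)
  finally have G: "G \<le> exp (2 * \<theta>\<^sup>2 * b * \<mu>\<^sup>2 + b * \<mu>\<^sup>2 * (w * (1 - w)))" .

  have "w * (1 - w) \<le> 1 / 4"
  proof -
    have "0 \<le> (w - 1 / 2)\<^sup>2" by simp
    then show ?thesis by (simp add: power2_eq_square algebra_simps)
  qed
  \<comment> \<open>The product \<open>cp * cm\<close> exceeds 1 by at least \<open>t\<close>. The
    resulting gain in \<open>cp powr (- b) + cm powr (- b)\<close> cancels the
    \<open>w * (1 - w)\<close> term in the bound on \<open>G\<close>.\<close>
  define t where "t = 4 * \<mu>\<^sup>2 * (w * (1 - w))"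
  have "\<mu>\<^sup>2 * (w * (1 - w)) \<le> 1 / 4 * (1 / 4)"
    using \<mu>2 \<open>w * (1 - w) \<le> 1 / 4\<close> w by (intro mult_mono) auto
  then have t: "0 \<le> t" "t \<le> 1" unfolding t_def using w by auto
  have e1: "exp \<mu> * exp (- \<mu>) = 1" by (simp add: exp_add[symmetric])
  have "cp * cm = w\<^sup>2 * (exp \<mu> * exp (- \<mu>)) + (1 - w)\<^sup>2 * (exp \<mu> * exp (- \<mu>))
      + w * (1 - w) * ((exp \<mu> - exp (- \<mu>))\<^sup>2 + 2 * (exp \<mu> * exp (- \<mu>)))"
    unfolding cp cm by algebra
  also have "\<dots> = 1 + w * (1 - w) * (exp \<mu> - exp (- \<mu>))\<^sup>2"
    unfolding e1 by algebra
  finally have cc: "cp * cm = 1 + w * (1 - w) * (exp \<mu> - exp (- \<mu>))\<^sup>2" .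
  have "(2 * \<mu>)\<^sup>2 \<le> (exp \<mu> - exp (- \<mu>))\<^sup>2"
    using exp_minus_exp_uminus_ge[OF \<mu>(1)] \<mu> by (intro power_mono) auto
  then have "w * (1 - w) * (2 * \<mu>)\<^sup>2 \<le> w * (1 - w) * (exp \<mu> - exp (- \<mu>))\<^sup>2"
    using w by (intro mult_left_mono) auto
  then have "1 + t \<le> cp * cm"
    unfolding t_def cc by (simp add: algebra_simps power2_eq_square)
  then have "exp (t / 2) \<le> cp * cm" using exp_half_le_one_plus[OF t] by linarith
  then have "t / 2 \<le> ln (cp * cm)" using pos by (intro iffD2[OF ln_ge_iff]) auto
  then have lsum: "2 * \<mu>\<^sup>2 * (w * (1 - w)) \<le> ln cp + ln cm"
    unfolding t_def using pos by (simp add: ln_mult algebra_simps)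
  have lb: "- \<mu> \<le> ln cp" "ln cp \<le> \<mu>" "- \<mu> \<le> ln cm" "ln cm \<le> \<mu>"
    using cpb cmb pos ln_le_cancel_iff[of cp "exp \<mu>"] ln_le_cancel_iff[of cm "exp \<mu>"]
    by (simp_all add: ln_ge_iff)
  \<comment> \<open>Half the logarithmic ratio: the sum of the two powers is twice the power
    \<open>- b\<close> of the geometric mean of \<open>cp\<close> and \<open>cm\<close>, times
    \<open>cosh (b * d)\<close>.\<close>
  define d where "d = (ln cp - ln cm) / 2"
  have "\<bar>d\<bar> \<le> \<mu>" unfolding d_def using lb by auto
  then have d2: "d\<^sup>2 \<le> \<mu>\<^sup>2" using abs_le_square_iff[of d \<mu>] \<mu> by simp
  have "cp powr (- b) + cm powr (- b) = 2 * (exp (- b * ((ln cp + ln cm) / 2)) * cosh (b * d))"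
    unfolding powr_def cosh_def d_def using pos
    by (simp add: field_simps exp_add[symmetric] exp_diff[symmetric])
  also have "\<dots> \<le> 2 * (exp (- b * (\<mu>\<^sup>2 * (w * (1 - w)))) * exp (b\<^sup>2 * \<mu>\<^sup>2 / 2))"
  proof (intro mult_left_mono mult_mono)
    have "b * (\<mu>\<^sup>2 * (w * (1 - w))) \<le> b * ((ln cp + ln cm) / 2)"
      using lsum b by (intro mult_left_mono) auto
    then show "exp (- b * ((ln cp + ln cm) / 2)) \<le> exp (- b * (\<mu>\<^sup>2 * (w * (1 - w))))" by simp
    have "cosh (b * d) \<le> exp ((b * d)\<^sup>2 / 2)" by (rule cosh_le_exp_half_square)
    also have "\<dots> \<le> exp (b\<^sup>2 * \<mu>\<^sup>2 / 2)"
      using d2 by (simp add: power_mult_distrib mult_left_mono)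
    finally show "cosh (b * d) \<le> exp (b\<^sup>2 * \<mu>\<^sup>2 / 2)" .
  qed auto
  finally have C: "cp powr (- b) + cm powr (- b) \<le>
      2 * (exp (- b * (\<mu>\<^sup>2 * (w * (1 - w)))) * exp (b\<^sup>2 * \<mu>\<^sup>2 / 2))" .

  have "w * exp \<mu> / cp * w powr (- a) + (1 - w) * exp (- \<mu>) / cp * (1 - w) powr (- a) \<le> G"
  proof (rule tiltG)
    show "w * exp \<mu> / cp + (1 - w) * exp (- \<mu>) / cp = 1"
      using pos unfolding add_divide_distrib[symmetric] cp by simp
  qed (use ratio[OF cpb(1), of _ w] ratio[OF cpb(1), of _ "1 - w"] w \<mu> in simp_all)
  moreover have "w * exp (- \<mu>) / cm * w powr (- a) + (1 - w) * exp \<mu> / cm * (1 - w) powr (- a) \<le> G"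
  proof (rule tiltG)
    show "w * exp (- \<mu>) / cm + (1 - w) * exp \<mu> / cm = 1"
      using pos unfolding add_divide_distrib[symmetric] cm by simp
  qed (use ratio[OF cmb(1), of _ w] ratio[OF cmb(1), of _ "1 - w"] w \<mu> in simp_all)
  ultimately have "cp powr (- b) * (w * exp \<mu> / cp * w powr (- a) + (1 - w) * exp (- \<mu>) / cp * (1 - w) powr (- a))
    + cm powr (- b) * (w * exp (- \<mu>) / cm * w powr (- a) + (1 - w) * exp \<mu> / cm * (1 - w) powr (- a))
    \<le> cp powr (- b) * G + cm powr (- b) * G"
    by (intro add_mono mult_left_mono) auto
  also have "\<dots> = (cp powr (- b) + cm powr (- b)) * G" by (simp add: algebra_simps)
  also have "\<dots> \<le> 2 * (exp (- b * (\<mu>\<^sup>2 * (w * (1 - w)))) * exp (b\<^sup>2 * \<mu>\<^sup>2 / 2)) *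
      exp (2 * \<theta>\<^sup>2 * b * \<mu>\<^sup>2 + b * \<mu>\<^sup>2 * (w * (1 - w)))"
  proof (intro mult_mono C G)
    have "0 \<le> w * w powr (- a) + (1 - w) * (1 - w) powr (- a)" using w by simp
    from order_trans[OF this tiltG[of w "1 - w"]] show "0 \<le> G" using w by simp
  qed simp
  also have "\<dots> = 2 * exp (b\<^sup>2 * \<mu>\<^sup>2 / 2 + 2 * \<theta>\<^sup>2 * b * \<mu>\<^sup>2)"
    by (simp add: exp_add[symmetric] algebra_simps)
  finally show ?thesis .
qed

section \<open>A negative moment of tilted averages\<close>

text \<open>The distinctness assumption replaces \<open>S \<subseteq> I \<rightarrow>\<^sub>E {-1, 1}\<close> so that in the induction \<open>S\<close> can be
  split by the value at a coordinate without changing its elements.\<close>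

lemma negative_moment_bound:
  fixes S :: "('a \<Rightarrow> real) set"
  assumes "finite I" and \<mu>: "0 \<le> \<mu>" "\<mu> \<le> 1 / 2" and b: "0 \<le> b" "b \<le> 1"
    and \<theta>: "0 < \<theta>" "\<theta> \<le> 1" and a: "a = \<theta> * b * \<mu>\<^sup>2 / 3"
    and "finite S" "S \<noteq> {}"
    and "\<And>y i. y \<in> S \<Longrightarrow> i \<in> I \<Longrightarrow> y i \<in> {-1, 1}"
    and "\<And>y z. y \<in> S \<Longrightarrow> z \<in> S \<Longrightarrow> (\<forall>i\<in>I. y i = z i) \<Longrightarrow> y = z"
  shows "(\<Sum>x\<in>I \<rightarrow>\<^sub>E {-1, 1}. ((\<Sum>y\<in>S. exp (\<mu> * (\<Sum>i\<in>I. x i * y i))) / card S) powr (- b))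
    \<le> (2 * exp (b\<^sup>2 * \<mu>\<^sup>2 / 2 + 2 * \<theta>\<^sup>2 * b * \<mu>\<^sup>2)) ^ card I * real (card S) powr (- a)"
  using assms(1, 9-)
proof (induction I arbitrary: S rule: finite_induct)
  case empty
  \<comment> \<open>Without coordinates, distinctness forces \<open>S\<close> to be a singleton, and
    both sides equal 1.\<close>
  then obtain y where "S = {y}" by blast
  then show ?case by simp
next
  case (insert i I)
  define K where "K = exp (b\<^sup>2 * \<mu>\<^sup>2 / 2 + 2 * \<theta>\<^sup>2 * b * \<mu>\<^sup>2)"
  define U where "U T x = (\<Sum>y\<in>T. exp (\<mu> * (\<Sum>i\<in>I. x i * y i)))" for T and x :: "'a \<Rightarrow> real"
  define V where "V T x = U T x / card T" for T x
  define W where "W s x = (\<Sum>y\<in>S. exp (\<mu> * (\<Sum>j\<in>insert i I. (x(i := s)) j * y j)))" for s x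
  define S1 where "S1 = {y \<in> S. y i = 1}"
  define S0 where "S0 = {y \<in> S. y i = -1}"
  have S: "S = S1 \<union> S0" "S1 \<inter> S0 = {}" "finite S1" "finite S0"
    unfolding S1_def S0_def using insert.prems by auto
  have card: "card S = card S1 + card S0"
    using S by (simp add: card_Un_disjoint)
  have IH: "(\<Sum>x\<in>I \<rightarrow>\<^sub>E {-1, 1}. V T x powr (- b)) \<le> (2 * K) ^ card I * real (card T) powr (- a)"
    if "T = S1 \<or> T = S0" "T \<noteq> {}" for T
    unfolding V_def U_def K_def
  proof (rule insert.IH)
    show "finite T" "T \<noteq> {}" using that S by auto
    show "y j \<in> {-1, 1}" if "y \<in> T" "j \<in> I" for y j
      using that \<open>T = S1 \<or> T = S0\<close> insert.prems(3)[of y j] S by auto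
    show "y = z" if "y \<in> T" "z \<in> T" "\<forall>i\<in>I. y i = z i" for y z
      using that \<open>T = S1 \<or> T = S0\<close> by (intro insert.prems(4)) (auto simp: S1_def S0_def)
  qed
  have W: "W s x = exp (\<mu> * s) * U S1 x + exp (- (\<mu> * s)) * U S0 x" for s x
  proof -
    have "W s x = (\<Sum>y\<in>S. exp (\<mu> * (s * y i)) * exp (\<mu> * (\<Sum>i\<in>I. x i * y i)))"
      unfolding W_def inner_fun_upd[OF insert(1,2)] by (simp add: exp_add[symmetric] algebra_simps)
    also have "\<dots> = (\<Sum>y\<in>S1. exp (\<mu> * (s * y i)) * exp (\<mu> * (\<Sum>i\<in>I. x i * y i)))
        + (\<Sum>y\<in>S0. exp (\<mu> * (s * y i)) * exp (\<mu> * (\<Sum>i\<in>I. x i * y i)))"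
      unfolding S(1) using S by (intro sum.union_disjoint) auto
    finally show ?thesis
      unfolding U_def sum_distrib_left by (simp add: S1_def S0_def)
  qed
  have Upos: "0 < U T x" if "T \<noteq> {}" "finite T" for T x
    unfolding U_def using that by (intro sum_pos) auto
  have Vpos: "0 < V T x" if "T \<noteq> {}" "finite T" for T x
    unfolding V_def using Upos[OF that] that by (simp add: card_gt_0_iff)
  have goal: "(\<Sum>x\<in>I \<rightarrow>\<^sub>E {-1, 1}. (W 1 x / card S) powr (- b) + (W (-1) x / card S) powr (- b))
      \<le> (2 * K) ^ Suc (card I) * real (card S) powr (- a)"
  proof (cases "S1 = {} \<or> S0 = {}")
    \<comment> \<open>A coordinate that is constant on \<open>S\<close> leaves the cardinality
      unchanged; summing over the new sign costs only the factor
      \<open>2 * cosh (b * \<mu>)\<close>.\<close>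
    case True
    obtain T s where T: "T = S1 \<or> T = S0" "S = T" "T \<noteq> {}"
      and s: "s = 1 \<or> s = -1" "\<And>t x. W t x = exp (\<mu> * (s * t)) * U T x"
    proof (cases "S0 = {}")
      case True
      then show ?thesis using that[of S1 1] S W insert.prems by (simp add: U_def)
    next
      case False
      then have "S1 = {}" using True by blast
      then show ?thesis using that[of S0 "-1"] S W insert.prems by (simp add: U_def)
    qed
    have eq: "(W t x / card S) powr (- b) = exp (- b * (\<mu> * (s * t))) * V T x powr (- b)" for t x
    proof -
      have "W t x / card S = exp (\<mu> * (s * t)) * V T x"
        unfolding s V_def T(2) by simp
      moreover have "0 < V T x" using Vpos[of T x] T S by auto
      ultimately show ?thesis by (simp add: powr_def ln_mult algebra_simps exp_diff exp_minus field_simps)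
    qed
    have "(W 1 x / card S) powr (- b) + (W (-1) x / card S) powr (- b) = 2 * cosh (b * \<mu>) * V T x powr (- b)" for x
      unfolding eq using s(1) by (auto simp: cosh_def algebra_simps)
    then have "(\<Sum>x\<in>I \<rightarrow>\<^sub>E {-1, 1}. (W 1 x / card S) powr (- b) + (W (-1) x / card S) powr (- b))
      = 2 * cosh (b * \<mu>) * (\<Sum>x\<in>I \<rightarrow>\<^sub>E {-1, 1}. V T x powr (- b))"
      by (simp add: sum_distrib_left)
    also have "\<dots> \<le> 2 * K * ((2 * K) ^ card I * real (card T) powr (- a))"
    proof (rule mult_mono)
      show "(\<Sum>x\<in>I \<rightarrow>\<^sub>E {-1, 1}. V T x powr (- b)) \<le> (2 * K) ^ card I * real (card T) powr (- a)"
        by (rule IH[OF T(1,3)])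
      have "cosh (b * \<mu>) \<le> exp ((b * \<mu>)\<^sup>2 / 2)" by (rule cosh_le_exp_half_square)
      also have "\<dots> \<le> K" unfolding K_def using b by (simp add: power_mult_distrib)
      finally show "2 * cosh (b * \<mu>) \<le> 2 * K" by simp
    qed (auto simp: K_def sum_nonneg)
    finally show ?thesis unfolding T(2) by simp
  next
    case False
    then have ne: "S1 \<noteq> {}" "S0 \<noteq> {}" by auto
    define w where "w = card S1 / card S"
    have cpos: "0 < card S1" "0 < card S0" using ne S by (auto simp: card_gt_0_iff)
    have w: "0 < w" "w < 1" "1 - w = card S0 / card S"
      unfolding w_def using cpos card by (auto simp: field_simps)
    define cp where "cp = w * exp \<mu> + (1 - w) * exp (- \<mu>)"
    define cm where "cm = w * exp (- \<mu>) + (1 - w) * exp \<mu>"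
    have pos: "0 < cp" "0 < cm" unfolding cp_def cm_def using w(1,2) by (auto intro!: add_pos_pos mult_pos_pos)
    have Wn: "W s x / card S = w * exp (\<mu> * s) * V S1 x + (1 - w) * exp (- (\<mu> * s)) * V S0 x" for s x
      unfolding W w(3) unfolding w_def V_def using cpos by (simp add: add_divide_distrib)
    \<comment> \<open>Dividing by the normalising constant \<open>c\<close> turns the tilted weights
      into a convex combination, to which convexity of the negative power applies.\<close>
    have step: "(w * e * P + (1 - w) * e' * Q) powr (- b)
        \<le> c powr (- b) * (w * e / c * P powr (- b) + (1 - w) * e' / c * Q powr (- b))"
      if "0 < e" "0 < e'" "c = w * e + (1 - w) * e'" "0 < c" "0 < P" "0 < Q" for e e' c P Q
    proof -
      have c: "(1 - w) * e' / c = 1 - w * e / c" using that by (simp add: field_simps)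
      have le1: "w * e / c \<le> 1" using that w by (simp add: field_simps)
      have "w * e * P + (1 - w) * e' * Q = c * (w * e / c * P + (1 - w * e / c) * Q)"
        unfolding c[symmetric] using that by (simp add: field_simps)
      also have "\<dots> powr (- b) = c powr (- b) * (w * e / c * P + (1 - w * e / c) * Q) powr (- b)"
        by (rule powr_mult)
      also have "\<dots> \<le> c powr (- b) * (w * e / c * P powr (- b) + (1 - w * e / c) * Q powr (- b))"
        using that w le1 b by (intro mult_left_mono powr_uminus_convex) auto
      finally show ?thesis unfolding c .
    qed
    define \<alpha> where "\<alpha> = cp powr (- b) * (w * exp \<mu> / cp) + cm powr (- b) * (w * exp (- \<mu>) / cm)"
    define \<beta> where "\<beta> = cp powr (- b) * ((1 - w) * exp (- \<mu>) / cp) + cm powr (- b) * ((1 - w) * exp \<mu> / cm)"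
    have \<alpha>\<beta>: "0 \<le> \<alpha>" "0 \<le> \<beta>" unfolding \<alpha>_def \<beta>_def using pos w by (auto intro!: add_nonneg_nonneg)
    let ?A = "\<lambda>T. \<Sum>x\<in>I \<rightarrow>\<^sub>E {-1, 1}. V T x powr (- b)"
    have "(\<Sum>x\<in>I \<rightarrow>\<^sub>E {-1, 1}. (W 1 x / card S) powr (- b) + (W (-1) x / card S) powr (- b))
      \<le> (\<Sum>x\<in>I \<rightarrow>\<^sub>E {-1, 1}. \<alpha> * V S1 x powr (- b) + \<beta> * V S0 x powr (- b))"
    proof (intro sum_mono)
      fix x :: "'a \<Rightarrow> real"
      have VV: "0 < V S1 x" "0 < V S0 x" using Vpos ne S by auto
      have "(W 1 x / card S) powr (- b) \<le>
          cp powr (- b) * (w * exp \<mu> / cp * V S1 x powr (- b) + (1 - w) * exp (- \<mu>) / cp * V S0 x powr (- b))"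
        unfolding Wn using step[of "exp \<mu>" "exp (- \<mu>)" cp] VV pos cp_def by simp
      moreover have "(W (-1) x / card S) powr (- b) \<le>
          cm powr (- b) * (w * exp (- \<mu>) / cm * V S1 x powr (- b) + (1 - w) * exp \<mu> / cm * V S0 x powr (- b))"
        unfolding Wn using step[of "exp (- \<mu>)" "exp \<mu>" cm] VV pos cm_def by simp
      ultimately show "(W 1 x / card S) powr (- b) + (W (-1) x / card S) powr (- b)
          \<le> \<alpha> * V S1 x powr (- b) + \<beta> * V S0 x powr (- b)"
        unfolding \<alpha>_def \<beta>_def by (simp add: algebra_simps)
    qed
    also have "\<dots> = \<alpha> * ?A S1 + \<beta> * ?A S0"
      by (simp add: sum.distrib sum_distrib_left)
    also have "\<dots> \<le> \<alpha> * ((2 * K) ^ card I * real (card S1) powr (- a))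
        + \<beta> * ((2 * K) ^ card I * real (card S0) powr (- a))"
      using IH ne \<alpha>\<beta> by (intro add_mono mult_left_mono) auto
    also have "\<dots> = (2 * K) ^ card I * real (card S) powr (- a) * (\<alpha> * w powr (- a) + \<beta> * (1 - w) powr (- a))"
    proof -
      \<comment> \<open>The two parts have \<open>w * card S\<close> and
        \<open>(1 - w) * card S\<close> points, so the induction hypotheses share the factor
        \<open>card S powr (- a)\<close> and leave the expression controlled by
        \<open>tilted_weights_le\<close>.\<close>
      have "real (card S1) powr (- a) = real (card S) powr (- a) * w powr (- a)"
        "real (card S0) powr (- a) = real (card S) powr (- a) * (1 - w) powr (- a)"
        unfolding w(3) unfolding w_def using card cpos by (simp_all add: powr_mult[symmetric])
      then show ?thesis by (simp add: algebra_simps)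
    qed
    also have "\<dots> \<le> (2 * K) ^ card I * real (card S) powr (- a) * (2 * K)"
    proof (intro mult_left_mono)
      have "\<alpha> * w powr (- a) + \<beta> * (1 - w) powr (- a) =
        cp powr (- b) * (w * exp \<mu> / cp * w powr (- a) + (1 - w) * exp (- \<mu>) / cp * (1 - w) powr (- a))
        + cm powr (- b) * (w * exp (- \<mu>) / cm * w powr (- a) + (1 - w) * exp \<mu> / cm * (1 - w) powr (- a))"
        unfolding \<alpha>_def \<beta>_def by (simp add: algebra_simps)
      also have "\<dots> \<le> 2 * K"
        unfolding K_def using w \<mu> b \<theta> a cp_def cm_def by (intro tilted_weights_le) auto
      finally show "\<alpha> * w powr (- a) + \<beta> * (1 - w) powr (- a) \<le> 2 * K" .
    qed (auto simp: K_def)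
    finally show ?thesis by (simp add: algebra_simps)
  qed
  show ?case
    unfolding sum_signs_insert[OF insert(1,2)] card_insert_disjoint[OF insert(1,2)]
    using goal unfolding W_def K_def .
qed

section \<open>The effect of one additional constraint\<close>

lemma finite_sign_cube [simp]: "finite (sign_cube N)"
  unfolding sign_cube_def by (intro finite_PiE) auto

lemma card_sign_cube [simp]: "card (sign_cube N) = 2 ^ N"
proof -
  have "card {-1, 1 :: real} = 2" by (subst card_2_iff) (intro exI[of _ "-1"] exI[of _ 1], simp)
  moreover have "card (sign_cube N) = (\<Prod>i\<in>{1..N}. card {-1, 1 :: real})"
    unfolding sign_cube_def by (rule card_PiE) (rule finite_atLeastAtMost)
  ultimately show ?thesis by (simp only: prod_constant card_atLeastAtMost diff_Suc_1)
qed

lemma sign_cube_values: "y \<in> sign_cube N \<Longrightarrow> i \<in> {1..N} \<Longrightarrow> y i \<in> {-1, 1}"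
  unfolding sign_cube_def by (rule PiE_mem)

lemma sign_cube_eqI:
  assumes "y \<in> sign_cube N" "z \<in> sign_cube N" "\<forall>i\<in>{1..N}. y i = z i"
  shows "y = z"
  using assms(3) by (intro PiE_ext[OF assms(1,2)[unfolded sign_cube_def]]) blast

lemma sum_exp_inner:
  fixes y :: "'a \<Rightarrow> real"
  assumes "finite I" "\<And>i. i \<in> I \<Longrightarrow> y i \<in> {-1, 1}"
  shows "(\<Sum>x\<in>I \<rightarrow>\<^sub>E {-1, 1}. exp (c * (\<Sum>i\<in>I. x i * y i))) = (2 * cosh c) ^ card I"
  using assms
proof (induction I rule: finite_induct)
  case empty
  then show ?case by simp
next
  case (insert i I)
  have "exp (c * (1 * y i + t)) + exp (c * ((-1) * y i + t)) = 2 * cosh c * exp (c * t)" for t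
    unfolding distrib_left exp_add
    using insert.prems[of i] by (auto simp: cosh_def algebra_simps)
  then show ?case
    unfolding sum_signs_insert[OF insert(1,2)] inner_fun_upd[OF insert(1,2)]
    using insert by (simp add: sum_distrib_left[symmetric])
qed

lemma cosh_power_le:
  assumes "N > 0"
  shows "cosh (c / sqrt (real N)) ^ N \<le> exp (c\<^sup>2 / 2)"
proof -
  have "cosh (c / sqrt (real N)) ^ N \<le> exp ((c / sqrt (real N))\<^sup>2 / 2) ^ N"
    by (intro power_mono cosh_le_exp_half_square) (simp add: cosh_real_nonneg)
  also have "\<dots> = exp (c\<^sup>2 / 2)"
    using assms by (simp add: exp_of_nat_mult[symmetric] power_divide)
  finally show ?thesis .
qed

text \<open>A Paley--Zygmund argument: points with \<open>g y < t\<close> carry at most half of the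
  exponential sum, and Cauchy--Schwarz converts the mass of the others into their number.\<close>

lemma tilted_second_moment:
  fixes g :: "'a \<Rightarrow> real"
  assumes "finite S" and "2 * real (card S) * exp t \<le> (\<Sum>y\<in>S. exp (g y))"
  shows "(\<Sum>y\<in>S. exp (g y))\<^sup>2 \<le> 4 * real (card {y \<in> S. t \<le> g y}) * (\<Sum>y\<in>S. exp (2 * g y))"
proof -
  let ?C = "{y \<in> S. t \<le> g y}"
  have C: "?C \<subseteq> S" "finite ?C" using assms by auto
  have "(\<Sum>y\<in>S. exp (g y)) = (\<Sum>y\<in>S - ?C. exp (g y)) + (\<Sum>y\<in>?C. exp (g y))"
    using assms C by (intro sum.subset_diff) auto
  moreover have "(\<Sum>y\<in>S - ?C. exp (g y)) \<le> (\<Sum>y\<in>S. exp t)"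
  proof -
    have "(\<Sum>y\<in>S - ?C. exp (g y)) \<le> (\<Sum>y\<in>S - ?C. exp t)" by (intro sum_mono) auto
    also have "\<dots> \<le> (\<Sum>y\<in>S. exp t)" using assms by (intro sum_mono2) auto
    finally show ?thesis .
  qed
  ultimately have "(\<Sum>y\<in>S. exp (g y)) \<le> 2 * (\<Sum>y\<in>?C. exp (g y))"
    using assms(2) by simp
  then have "(\<Sum>y\<in>S. exp (g y))\<^sup>2 \<le> (2 * (\<Sum>y\<in>?C. 1 * exp (g y)))\<^sup>2"
    by (intro power_mono) (auto intro: sum_nonneg)
  also have "\<dots> = 4 * (\<Sum>y\<in>?C. 1 * exp (g y))\<^sup>2" by (simp add: power_mult_distrib)
  also have "\<dots> \<le> 4 * ((\<Sum>y\<in>?C. 1\<^sup>2) * (\<Sum>y\<in>?C. (exp (g y))\<^sup>2))"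
    by (intro mult_left_mono Cauchy_Schwarz_ineq_sum) auto
  also have "\<dots> \<le> 4 * ((\<Sum>y\<in>?C. 1\<^sup>2) * (\<Sum>y\<in>S. (exp (g y))\<^sup>2))"
    using assms C by (intro mult_left_mono sum_mono2) (auto intro: sum_nonneg)
  also have "\<dots> = 4 * real (card ?C) * (\<Sum>y\<in>S. exp (2 * g y))"
    by (simp add: exp_double)
  finally show ?thesis .
qed

lemma card_markov:
  fixes f :: "'a \<Rightarrow> real"
  assumes "finite X" "\<And>x. x \<in> X \<Longrightarrow> 0 \<le> f x" "0 < c" "(\<Sum>x\<in>X. f x) \<le> c * d"
  shows "real (card {x \<in> X. c \<le> f x}) \<le> d"
proof -
  have "c * real (card {x \<in> X. c \<le> f x}) = (\<Sum>x\<in>{x \<in> X. c \<le> f x}. c)" by simp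
  also have "\<dots> \<le> (\<Sum>x\<in>{x \<in> X. c \<le> f x}. f x)" by (intro sum_mono) auto
  also have "\<dots> \<le> (\<Sum>x\<in>X. f x)" using assms by (intro sum_mono2) auto
  finally show ?thesis using assms by (metis mult_le_cancel_left_pos order_trans)
qed

text \<open>A constraint can be destructive only if the tilted average \<open>V \<mu> x\<close> is
  too small or \<open>V (2 * \<mu>) x\<close> is too large. Markov's inequality makes the former
  rare through the negative moment and the latter through the first moment. Otherwise
  \<open>tilted_second_moment\<close> yields enough points with overlap at least
  \<open>\<bar>\<kappa>\<bar> * sqrt N\<close>.\<close>

lemma few_destructive_constraints:
  assumes N: "N > 0" and S: "S \<subseteq> sign_cube N" "exp (\<eta> * N) \<le> card S"
    and \<eta>: "0 < \<eta>" "\<eta> \<le> 1" and s: "0 \<le> s" "s \<le> sqrt N / 2"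
    and \<kappa>: "s * \<bar>\<kappa>\<bar> + ln 2 \<le> s\<^sup>2 * \<eta>\<^sup>2 / 288"
  shows "real (card {x \<in> sign_cube N. card (S \<inter> half_cube \<kappa> N x) < exp (- (3 * s\<^sup>2)) * card S})
    \<le> 2 * exp (- (s\<^sup>2 * \<eta> ^ 4 / 20736)) * 2 ^ N"
proof -
  define \<mu> where "\<mu> = s / sqrt N"
  \<comment> \<open>\<open>\<theta>\<close> minimises
    \<open>2 * \<theta>^2 - \<theta> * \<eta> / 3\<close>, and \<open>b\<close> then minimises
    \<open>b * (b / 2 - \<eta>^2 / 72)\<close>, the coefficient of \<open>s^2\<close> in the
    exponent of the moment bound.\<close>
  define \<theta> where "\<theta> = \<eta> / 12"
  define b where "b = \<eta>\<^sup>2 / 72"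
  define a where "a = \<theta> * b * \<mu>\<^sup>2 / 3"
  define ov where "ov x y = (\<Sum>i=1..N. x i * y i)" for x y :: "nat \<Rightarrow> real"
  define V where "V c x = (\<Sum>y\<in>S. exp (c * ov x y)) / card S" for c x
  define \<epsilon> where "\<epsilon> = exp (- (s\<^sup>2 * \<eta> ^ 4 / 20736))"
  have \<eta>2: "\<eta>\<^sup>2 \<le> 1" "\<eta> ^ 4 \<le> 1" using \<eta> by (auto intro!: power_le_one)
  have par: "0 \<le> \<mu>" "\<mu> \<le> 1 / 2" "0 < b" "b \<le> 1" "0 < \<theta>" "\<theta> \<le> 1"
    unfolding \<mu>_def \<theta>_def b_def using s N \<eta> \<eta>2 by (auto simp: field_simps)
  have finS: "finite S" using S finite_subset by fastforce
  have cardS: "0 < card S" using S(2) exp_gt_zero[of "\<eta> * N"] by linarith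
  have neS: "S \<noteq> {}" using cardS by auto
  have \<mu>N: "\<mu>\<^sup>2 * N = s\<^sup>2" unfolding \<mu>_def using N by (simp add: power_divide)
  have Vpos: "0 < V c x" for c x
    unfolding V_def using neS finS cardS by (intro divide_pos_pos sum_pos) auto

  have "(\<Sum>x\<in>sign_cube N. V \<mu> x powr (- b)) \<le>
      (2 * exp (b\<^sup>2 * \<mu>\<^sup>2 / 2 + 2 * \<theta>\<^sup>2 * b * \<mu>\<^sup>2)) ^ card {1..N} * real (card S) powr (- a)"
    unfolding V_def ov_def sign_cube_def
  proof (rule negative_moment_bound)
    show "y i \<in> {-1, 1}" if "y \<in> S" "i \<in> {1..N}" for y i
      using that S sign_cube_values by blast
    show "y = z" if "y \<in> S" "z \<in> S" "\<forall>i\<in>{1..N}. y i = z i" for y z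
      using that S sign_cube_eqI by blast
  qed (use par finS neS a_def in auto)
  also have "\<dots> \<le> (2 * exp (b\<^sup>2 * \<mu>\<^sup>2 / 2 + 2 * \<theta>\<^sup>2 * b * \<mu>\<^sup>2)) ^ N * exp (- a * (\<eta> * N))"
  proof -
    have "\<eta> * N \<le> ln (card S)" using S(2) cardS by (simp add: ln_ge_iff)
    then have "- a * ln (card S) \<le> - a * (\<eta> * N)"
      unfolding a_def using par by (intro mult_left_mono_neg) auto
    then have "real (card S) powr (- a) \<le> exp (- a * (\<eta> * N))"
      using cardS by (simp add: powr_def)
    then show ?thesis by simp
  qed
  also have "\<dots> = 2 ^ N * exp (N * (b\<^sup>2 * \<mu>\<^sup>2 / 2 + 2 * \<theta>\<^sup>2 * b * \<mu>\<^sup>2) - a * (\<eta> * N))"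
    by (simp add: power_mult_distrib exp_of_nat_mult[symmetric] exp_add[symmetric] exp_diff exp_minus field_simps)
  also have "N * (b\<^sup>2 * \<mu>\<^sup>2 / 2 + 2 * \<theta>\<^sup>2 * b * \<mu>\<^sup>2) - a * (\<eta> * N)
      = (\<mu>\<^sup>2 * N) * (b * (b / 2 + 2 * \<theta>\<^sup>2 - \<theta> * \<eta> / 3))"
    unfolding a_def by (simp add: algebra_simps power2_eq_square)
  \<comment> \<open>The exponent is \<open>- (b * s^2 * \<eta>^2 / 144)\<close>. One half becomes
    the Markov threshold; the other half, \<open>s^2 * \<eta>^4 / 20736\<close> in absolute value,
    is the exponent of \<open>\<epsilon>\<close>.\<close>
  also have "\<dots> = - (b * (s\<^sup>2 * \<eta>\<^sup>2 / 288)) - s\<^sup>2 * \<eta> ^ 4 / 20736"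
    unfolding \<mu>N unfolding \<theta>_def b_def by (simp add: field_simps power2_eq_square power4_eq_xxxx)
  also have "2 ^ N * exp (- (b * (s\<^sup>2 * \<eta>\<^sup>2 / 288)) - s\<^sup>2 * \<eta> ^ 4 / 20736)
      = exp (- (b * (s\<^sup>2 * \<eta>\<^sup>2 / 288))) * (\<epsilon> * 2 ^ N)"
    unfolding \<epsilon>_def diff_conv_add_uminus exp_add by simp
  finally have B1: "real (card {x \<in> sign_cube N. exp (- (b * (s\<^sup>2 * \<eta>\<^sup>2 / 288))) \<le> V \<mu> x powr (- b)})
      \<le> \<epsilon> * 2 ^ N"
    by (intro card_markov) auto

  have "(\<Sum>x\<in>sign_cube N. V (2 * \<mu>) x) = (\<Sum>y\<in>S. \<Sum>x\<in>sign_cube N. exp (2 * \<mu> * ov x y)) / card S"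
    unfolding V_def sum_divide_distrib[symmetric] by (subst sum.swap) simp
  also have "(\<Sum>y\<in>S. \<Sum>x\<in>sign_cube N. exp (2 * \<mu> * ov x y)) = (\<Sum>y\<in>S. (2 * cosh (2 * \<mu>)) ^ N)"
  proof (intro sum.cong refl)
    fix y assume "y \<in> S"
    then show "(\<Sum>x\<in>sign_cube N. exp (2 * \<mu> * ov x y)) = (2 * cosh (2 * \<mu>)) ^ N"
      unfolding ov_def sign_cube_def using sign_cube_values S
      by (subst sum_exp_inner) auto
  qed
  also have "\<dots> / card S = 2 ^ N * cosh ((2 * s) / sqrt N) ^ N"
    using cardS by (simp add: power_mult_distrib \<mu>_def)
  also have "\<dots> \<le> 2 ^ N * exp ((2 * s)\<^sup>2 / 2)"
    using N by (intro mult_left_mono cosh_power_le) auto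
  also have "\<dots> = exp (3 * s\<^sup>2) * (exp (- s\<^sup>2) * 2 ^ N)"
    by (simp add: exp_add[symmetric] power_mult_distrib)
  also have "\<dots> \<le> exp (3 * s\<^sup>2) * (\<epsilon> * 2 ^ N)"
  proof -
    have "s\<^sup>2 * \<eta> ^ 4 / 20736 \<le> s\<^sup>2 * 1 / 1"
      using \<eta>2 by (intro frac_le mult_left_mono) auto
    then show ?thesis unfolding \<epsilon>_def by simp
  qed
  finally have B2: "real (card {x \<in> sign_cube N. exp (3 * s\<^sup>2) \<le> V (2 * \<mu>) x}) \<le> \<epsilon> * 2 ^ N"
    using Vpos by (intro card_markov) (auto intro: less_imp_le)

  have good: "exp (- (3 * s\<^sup>2)) * card S \<le> card (S \<inter> half_cube \<kappa> N x)"
    if x: "x \<in> sign_cube N" "V \<mu> x powr (- b) < exp (- (b * (s\<^sup>2 * \<eta>\<^sup>2 / 288)))"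
      "V (2 * \<mu>) x < exp (3 * s\<^sup>2)" for x
  proof -
    have "- b * ln (V \<mu> x) < - b * (s\<^sup>2 * \<eta>\<^sup>2 / 288)"
      using x(2) Vpos[of \<mu> x] by (simp add: powr_def)
    then have "s\<^sup>2 * \<eta>\<^sup>2 / 288 < ln (V \<mu> x)" using par by (simp del: times_divide_eq_right)
    then have "s * \<bar>\<kappa>\<bar> + ln 2 \<le> ln (V \<mu> x)" using \<kappa> by linarith
    then have "exp (s * \<bar>\<kappa>\<bar> + ln 2) \<le> V \<mu> x" using Vpos[of \<mu> x] by (simp add: ln_ge_iff)
    then have V2: "2 * exp (s * \<bar>\<kappa>\<bar>) \<le> V \<mu> x" by (simp add: exp_add)
    let ?C = "{y \<in> S. s * \<bar>\<kappa>\<bar> \<le> \<mu> * ov x y}"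
    have "(\<Sum>y\<in>S. exp (\<mu> * ov x y))\<^sup>2 \<le> 4 * real (card ?C) * (\<Sum>y\<in>S. exp (2 * (\<mu> * ov x y)))"
    proof (rule tilted_second_moment[OF finS])
      show "2 * real (card S) * exp (s * \<bar>\<kappa>\<bar>) \<le> (\<Sum>y\<in>S. exp (\<mu> * ov x y))"
        using V2 cardS unfolding V_def by (simp add: field_simps)
    qed
    then have "(card S * V \<mu> x)\<^sup>2 \<le> 4 * real (card ?C) * (card S * V (2 * \<mu>) x)"
      unfolding V_def using cardS by (simp add: mult.assoc)
    then have "card S * (V \<mu> x)\<^sup>2 \<le> 4 * real (card ?C) * V (2 * \<mu>) x"
      using cardS by (simp add: power_mult_distrib power2_eq_square mult.assoc mult.left_commute)
    also have "\<dots> \<le> 4 * real (card ?C) * exp (3 * s\<^sup>2)"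
      using x(3) by (intro mult_left_mono) auto
    finally have 1: "card S * (V \<mu> x)\<^sup>2 \<le> 4 * real (card ?C) * exp (3 * s\<^sup>2)" .
    \<comment> \<open>The bound \<open>2 \<le> V \<mu> x\<close> pays for the factor 4 from
      \<open>tilted_second_moment\<close>.\<close>
    have "1 \<le> exp (s * \<bar>\<kappa>\<bar>)" using s by simp
    then have "2 \<le> V \<mu> x" using V2 by linarith
    then have "2\<^sup>2 \<le> (V \<mu> x)\<^sup>2" by (intro power_mono) auto
    then have "real (card S) * 2\<^sup>2 \<le> real (card S) * (V \<mu> x)\<^sup>2" by (intro mult_left_mono) auto
    with 1 have "card S \<le> real (card ?C) * exp (3 * s\<^sup>2)" by simp
    then have "exp (- (3 * s\<^sup>2)) * card S \<le> card ?C" by (simp add: exp_minus field_simps)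
    moreover have "?C \<subseteq> S \<inter> half_cube \<kappa> N x"
    proof
      fix y assume y: "y \<in> ?C"
      show "y \<in> S \<inter> half_cube \<kappa> N x"
      proof (cases "s = 0")
        \<comment> \<open>For \<open>s = 0\<close> the hypothesis on \<open>\<kappa>\<close> would
          read \<open>ln 2 \<le> 0\<close>.\<close>
        case True
        then show ?thesis using \<kappa> by simp
      next
        case False
        then have "0 < s" using s by simp
        have "s * \<bar>\<kappa>\<bar> \<le> s * ov x y / sqrt N" using y unfolding \<mu>_def by simp
        then have "s * \<bar>\<kappa>\<bar> * sqrt N \<le> s * ov x y"
          using N by (subst (asm) pos_le_divide_eq) auto
        then have "\<bar>\<kappa>\<bar> * sqrt N \<le> ov x y"
          using \<open>0 < s\<close> mult_le_cancel_left_pos[of s "\<bar>\<kappa>\<bar> * sqrt N" "ov x y"] by (simp add: mult.assoc)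
        moreover have "\<kappa> * sqrt N \<le> \<bar>\<kappa>\<bar> * sqrt N" by (intro mult_right_mono) auto
        ultimately show ?thesis using y S unfolding half_cube_def ov_def by auto
      qed
    qed
    then have "card ?C \<le> card (S \<inter> half_cube \<kappa> N x)"
      using finS by (intro card_mono) auto
    ultimately show ?thesis by linarith
  qed
  have "{x \<in> sign_cube N. card (S \<inter> half_cube \<kappa> N x) < exp (- (3 * s\<^sup>2)) * card S} \<subseteq>
      {x \<in> sign_cube N. exp (- (b * (s\<^sup>2 * \<eta>\<^sup>2 / 288))) \<le> V \<mu> x powr (- b)} \<union>
      {x \<in> sign_cube N. exp (3 * s\<^sup>2) \<le> V (2 * \<mu>) x}"
  proof
    fix x assume x: "x \<in> {x \<in> sign_cube N. card (S \<inter> half_cube \<kappa> N x) < exp (- (3 * s\<^sup>2)) * card S}"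
    show "x \<in> {x \<in> sign_cube N. exp (- (b * (s\<^sup>2 * \<eta>\<^sup>2 / 288))) \<le> V \<mu> x powr (- b)} \<union>
      {x \<in> sign_cube N. exp (3 * s\<^sup>2) \<le> V (2 * \<mu>) x}"
    proof (rule ccontr)
      assume "\<not> ?thesis"
      then have "V \<mu> x powr (- b) < exp (- (b * (s\<^sup>2 * \<eta>\<^sup>2 / 288)))" "V (2 * \<mu>) x < exp (3 * s\<^sup>2)"
        using x by (simp_all add: not_le)
      with good[of x] x show False by simp
    qed
  qed
  then have "real (card {x \<in> sign_cube N. card (S \<inter> half_cube \<kappa> N x) < exp (- (3 * s\<^sup>2)) * card S})
      \<le> real (card ({x \<in> sign_cube N. exp (- (b * (s\<^sup>2 * \<eta>\<^sup>2 / 288))) \<le> V \<mu> x powr (- b)} \<union>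
        {x \<in> sign_cube N. exp (3 * s\<^sup>2) \<le> V (2 * \<mu>) x}))"
    by (intro of_nat_mono card_mono) auto
  also have "\<dots> \<le> \<epsilon> * 2 ^ N + \<epsilon> * 2 ^ N"
    using B1 B2 card_Un_le[of "{x \<in> sign_cube N. exp (- (b * (s\<^sup>2 * \<eta>\<^sup>2 / 288))) \<le> V \<mu> x powr (- b)}"
        "{x \<in> sign_cube N. exp (3 * s\<^sup>2) \<le> V (2 * \<mu>) x}"] by linarith
  also have "\<epsilon> * 2 ^ N + \<epsilon> * 2 ^ N = 2 * exp (- (s\<^sup>2 * \<eta> ^ 4 / 20736)) * 2 ^ N"
    unfolding \<epsilon>_def by simp
  finally show ?thesis .
qed

text \<open>Paley--Zygmund over the constraints \<open>x\<close>, with the negative tilt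
  \<open>- c\<close> where \<open>c = s / sqrt N\<close> and \<open>s\<close> depends on
  \<open>\<kappa>\<close> only. The normalised tilted moments stay bounded in \<open>N\<close>, so
  the fraction \<open>q\<close> depends neither on \<open>N\<close> nor on \<open>y\<close>.\<close>

lemma excluding_constraints_lower_bound:
  "\<exists>q>0. \<exists>N\<^sub>0::nat. \<forall>N\<ge>N\<^sub>0. \<forall>y\<in>sign_cube N.
    q * 2 ^ N \<le> real (card {x \<in> sign_cube N. y \<notin> half_cube \<kappa> N x})"
proof -
  \<comment> \<open>Chosen so that \<open>s^2 / 4 = s + s * (\<bar>\<kappa>\<bar> + 1)\<close>: the
    lower bound \<open>exp (s^2 / 4)\<close> on the moment covers both the factor 2 and the
    threshold.\<close>
  define s where "s = 4 * (\<bar>\<kappa>\<bar> + 2)"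
  define q where "q = exp (- (2 * s\<^sup>2)) / 4"
  have s: "8 \<le> s" unfolding s_def by simp
  have "q * 2 ^ N \<le> real (card {x \<in> sign_cube N. y \<notin> half_cube \<kappa> N x})"
    if N: "nat \<lceil>s\<^sup>2\<rceil> \<le> N" and y: "y \<in> sign_cube N" for N y
  proof -
    have Ns: "s\<^sup>2 \<le> N" using N by linarith
    have "0 < s\<^sup>2" using s by simp
    then have Npos: "0 < N" using Ns by (cases N) auto
    define c where "c = s / sqrt N"
    have c2: "c\<^sup>2 = s\<^sup>2 / N" unfolding c_def by (simp add: power_divide)
    define ov where "ov x = (\<Sum>i=1..N. x i * y i)" for x :: "nat \<Rightarrow> real"
    have moment: "(\<Sum>x\<in>sign_cube N. exp (d * ov x)) = 2 ^ N * cosh d ^ N" for d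
      unfolding ov_def sign_cube_def using sign_cube_values[OF y]
      by (subst sum_exp_inner) (auto simp: power_mult_distrib)
    have "exp (s\<^sup>2 / 4) = exp (c\<^sup>2 / 2 / 2) ^ N"
      using Npos by (simp add: c2 exp_of_nat_mult[symmetric])
    also have "\<dots> \<le> (1 + c\<^sup>2 / 2) ^ N"
      using Ns Npos by (intro power_mono exp_half_le_one_plus) (auto simp: c2 field_simps)
    also have "\<dots> \<le> cosh c ^ N" by (intro power_mono one_plus_le_cosh) auto
    finally have low: "exp (s\<^sup>2 / 4) \<le> cosh c ^ N" .
    have "2 * exp (s * (\<bar>\<kappa>\<bar> + 1)) \<le> exp s * exp (s * (\<bar>\<kappa>\<bar> + 1))"
    proof (intro mult_right_mono)
      show "2 \<le> exp s" using s exp_ge_add_one_self[of s] by linarith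
    qed simp
    also have "\<dots> = exp (s\<^sup>2 / 4)" unfolding exp_add[symmetric] s_def
      by (simp add: power2_eq_square algebra_simps)
    finally have "2 * 2 ^ N * exp (s * (\<bar>\<kappa>\<bar> + 1)) \<le> 2 ^ N * exp (s\<^sup>2 / 4)" by simp
    also have "\<dots> \<le> 2 ^ N * cosh c ^ N" using low by simp
    finally have 1: "2 * real (card (sign_cube N)) * exp (s * (\<bar>\<kappa>\<bar> + 1)) \<le> (\<Sum>x\<in>sign_cube N. exp (- c * ov x))"
      unfolding moment by simp
    let ?C = "{x \<in> sign_cube N. s * (\<bar>\<kappa>\<bar> + 1) \<le> - c * ov x}"
    have "1 \<le> cosh c ^ N" using cosh_real_ge_1[of c] by simp
    then have "1\<^sup>2 \<le> (cosh c ^ N)\<^sup>2" by (intro power_mono) auto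
    then have "(2 ^ N)\<^sup>2 * 1\<^sup>2 \<le> (2 ^ N)\<^sup>2 * (cosh c ^ N)\<^sup>2"
      by (intro mult_left_mono) auto
    also have "\<dots> = (\<Sum>x\<in>sign_cube N. exp (- c * ov x))\<^sup>2"
      unfolding moment by (simp add: power_mult_distrib)
    also have "\<dots> \<le> 4 * real (card ?C) * (\<Sum>x\<in>sign_cube N. exp (2 * (- c * ov x)))"
      using 1 by (intro tilted_second_moment) auto
    also have "(\<Sum>x\<in>sign_cube N. exp (2 * (- c * ov x))) = 2 ^ N * cosh ((2 * s) / sqrt N) ^ N"
      using moment[of "- (2 * c)"] by (simp add: c_def mult.assoc)
    also have "4 * real (card ?C) * \<dots> \<le> 4 * real (card ?C) * (2 ^ N * exp ((2 * s)\<^sup>2 / 2))"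
      using Npos by (intro mult_left_mono cosh_power_le) auto
    finally have "2 ^ N \<le> 4 * real (card ?C) * exp (2 * s\<^sup>2)"
      by (simp add: power2_eq_square)
    then have "q * 2 ^ N \<le> real (card ?C)"
      unfolding q_def by (simp add: exp_minus field_simps)
    also have "\<dots> \<le> real (card {x \<in> sign_cube N. y \<notin> half_cube \<kappa> N x})"
    proof (intro of_nat_mono card_mono subsetI)
      fix x assume x: "x \<in> ?C"
      have "s * (\<bar>\<kappa>\<bar> + 1) \<le> s * (- ov x) / sqrt N" using x unfolding c_def by simp
      then have "s * (\<bar>\<kappa>\<bar> + 1) * sqrt N \<le> s * (- ov x)"
        using Npos by (subst (asm) pos_le_divide_eq) auto
      then have "(\<bar>\<kappa>\<bar> + 1) * sqrt N \<le> - ov x"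
        using s mult_le_cancel_left_pos[of s "(\<bar>\<kappa>\<bar> + 1) * sqrt N" "- ov x"] by (simp add: mult.assoc)
      \<comment> \<open>The additional 1 in the threshold puts the overlap strictly below
        \<open>\<kappa> * sqrt N\<close>, as exclusion requires.\<close>
      moreover have "- ((\<bar>\<kappa>\<bar> + 1) * sqrt N) < \<kappa> * sqrt N"
      proof -
        have "- (\<bar>\<kappa>\<bar> + 1) * sqrt N < \<kappa> * sqrt N" using Npos by (intro mult_strict_right_mono) auto
        then show ?thesis by (simp add: algebra_simps)
      qed
      ultimately show "x \<in> {x \<in> sign_cube N. y \<notin> half_cube \<kappa> N x}"
        using x unfolding half_cube_def ov_def by auto
    qed auto
    finally show ?thesis .
  qed
  moreover have "q > 0" unfolding q_def by simp
  ultimately show ?thesis by blast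
qed

section \<open>The perceptron model\<close>

text \<open>Adding the elements of \<open>X\<close> one at a time must switch \<open>Q\<close> at
  some point; the pair found is a pivotal configuration for Russo's formula.\<close>

lemma first_switch:
  assumes "finite X" "\<not> Q {}" "Q X"
  shows "\<exists>A x. A \<subseteq> X \<and> x \<in> X - A \<and> \<not> Q A \<and> Q (insert x A)"
  using assms
proof (induction X rule: finite_induct)
  case (insert z X)
  show ?case
  proof (cases "Q X")
    case True
    then show ?thesis using insert by blast
  next
    case False
    then show ?thesis using insert by blast
  qed
qed simp

text \<open>Russo's formula expresses the derivative through nonnegative terms, and a pivotal pair
  makes one of them positive because every subset has positive weight at interior densities.\<close>

lemma increasing_event_strict_mono:
  fixes Q :: "'a set \<Rightarrow> bool"
  assumes X: "finite X" "\<not> Q {}" "Q X"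
    and up: "\<And>A x. A \<subseteq> X \<Longrightarrow> x \<in> X \<Longrightarrow> Q A \<Longrightarrow> Q (insert x A)"
    and p: "0 \<le> p" "p < r" "r \<le> 1"
  shows "subset_mean X p (\<lambda>A. of_bool (Q A)) < subset_mean X r (\<lambda>A. of_bool (Q A))"
proof (rule DERIV_pos_imp_increasing_open[OF p(2)])
  let ?f = "\<lambda>A. of_bool (Q A) :: real"
  show "\<exists>D. ((\<lambda>p. subset_mean X p ?f) has_real_derivative D) (at t) \<and> 0 < D" if t: "p < t" "t < r" for t
  proof -
    obtain D where D: "((\<lambda>p. subset_mean X p ?f) has_real_derivative D) (at t)"
      "(1 - t) * D = subset_mean X t (\<lambda>A. \<Sum>x\<in>X - A. ?f (insert x A) - ?f A)"
      using subset_mean_has_derivative[OF X(1)] by blast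
    obtain A x where A: "A \<subseteq> X" "x \<in> X - A" "\<not> Q A" "Q (insert x A)"
      using first_switch[OF X(1), of Q] X by blast
    have nonneg: "0 \<le> ?f (insert x A) - ?f A" if "A \<subseteq> X" "x \<in> X - A" for A x
      using up[of A x] that by auto
    have pos: "0 < (\<Sum>x\<in>X - A. ?f (insert x A) - ?f A)"
      using A X nonneg by (intro sum_pos2[of _ x]) auto
    have "0 < (1 - t) * D"
      unfolding D(2) subset_mean_def
    proof (rule sum_pos2)
      show "finite (Pow X)" "A \<in> Pow X" using X A by auto
      show "0 < t ^ card A * (1 - t) ^ card (X - A) * (\<Sum>x\<in>X - A. ?f (insert x A) - ?f A)"
        using t p pos by simp
      show "0 \<le> t ^ card B * (1 - t) ^ card (X - B) * (\<Sum>x\<in>X - B. ?f (insert x B) - ?f B)"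
        if "B \<in> Pow X" for B
        using t p that nonneg[of B] by (intro mult_nonneg_nonneg sum_nonneg) auto
    qed
    then have "0 < D" using t p by (simp add: zero_less_mult_iff)
    with D show ?thesis by blast
  qed
  have "isCont (\<lambda>p. subset_mean X p ?f) t" for t
    using subset_mean_has_derivative[OF X(1), of ?f t] DERIV_isCont by blast
  then show "continuous_on {p..r} (\<lambda>p. subset_mean X p ?f)"
    by (intro continuous_at_imp_continuous_on) auto
qed

section \<open>Solution sets as functions of the set of constraints\<close>

definition satisfying :: "real \<Rightarrow> nat \<Rightarrow> (nat \<Rightarrow> real) set \<Rightarrow> (nat \<Rightarrow> real) set" where
  "satisfying \<kappa> N A = solution_set \<kappa> N (\<lambda>x. x \<in> A)"

lemma satisfying_iff:
  "y \<in> satisfying \<kappa> N A \<longleftrightarrow> y \<in> sign_cube N \<and> (\<forall>x\<in>A \<inter> sign_cube N. y \<in> half_cube \<kappa> N x)"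
  by (auto simp: satisfying_def solution_set_def)

lemma satisfying_subset: "satisfying \<kappa> N A \<subseteq> sign_cube N"
  by (auto simp: satisfying_iff)

lemma finite_satisfying [simp]: "finite (satisfying \<kappa> N A)"
  using satisfying_subset finite_sign_cube by (rule finite_subset)

lemma satisfying_empty: "satisfying \<kappa> N {} = sign_cube N"
  by (auto simp: satisfying_iff)

lemma satisfying_insert:
  "x \<in> sign_cube N \<Longrightarrow> satisfying \<kappa> N (insert x A) = satisfying \<kappa> N A \<inter> half_cube \<kappa> N x"
  by (auto simp: satisfying_iff)

text \<open>Reads new constraints from the side of each solution: \<open>y\<close> survives when
  \<open>B\<close> avoids the constraints excluding it, an event whose probability
  \<open>subset_mean_disjoint\<close> computes.\<close>

lemma satisfying_Un:
  assumes "B \<subseteq> sign_cube N"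
  shows "satisfying \<kappa> N (A \<union> B) =
    {y \<in> satisfying \<kappa> N A. B \<inter> {x \<in> sign_cube N. y \<notin> half_cube \<kappa> N x} = {}}"
  using assms by (auto simp: satisfying_iff)

text \<open>Each \<open>y\<close> violates the constraint given by \<open>- y\<close>, whose overlap
  with \<open>y\<close> is \<open>- N\<close>.\<close>

lemma satisfying_all:
  assumes "N > 0" "- \<kappa> < sqrt N"
  shows "satisfying \<kappa> N (sign_cube N) = {}"
proof (rule equals0I)
  fix y assume "y \<in> satisfying \<kappa> N (sign_cube N)"
  then have y: "y \<in> sign_cube N" "\<And>x. x \<in> sign_cube N \<Longrightarrow> y \<in> half_cube \<kappa> N x"
    by (auto simp: satisfying_iff)
  let ?x = "\<lambda>i\<in>{1..N}. - y i"
  have signs: "y i = 1 \<or> y i = -1" if "i \<in> {1..N}" for i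
    using sign_cube_values[OF y(1) that] by auto
  have "?x \<in> sign_cube N"
    unfolding sign_cube_def
  proof (intro PiE_I)
    show "?x i \<in> {-1, 1}" if "i \<in> {1..N}" for i using signs[OF that] that by auto
  qed auto
  then have "\<kappa> * sqrt N \<le> (\<Sum>i=1..N. ?x i * y i)" using y(2) unfolding half_cube_def by blast
  also have "\<dots> = (\<Sum>i=1..N. - 1)"
  proof (intro sum.cong refl)
    show "?x i * y i = - 1" if "i \<in> {1..N}" for i using signs[OF that] that by auto
  qed
  also have "\<dots> = - sqrt N * sqrt N" by simp
  finally have "\<kappa> \<le> - sqrt N" using assms(1) by (subst (asm) mult_le_cancel_right_pos) auto
  then show False using assms(2) by simp
qed

section \<open>The unsatisfiability probability and its quantiles\<close>

lemma prob_unsat_eq: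
  assumes "0 \<le> p" "p \<le> 1"
  shows "prob_unsat \<kappa> N p = subset_mean (sign_cube N) p (\<lambda>A. of_bool (satisfying \<kappa> N A = {}))"
proof -
  have "solution_set \<kappa> N \<omega> = satisfying \<kappa> N {x \<in> sign_cube N. \<omega> x}" for \<omega>
    by (auto simp: satisfying_def solution_set_def)
  then show ?thesis
    unfolding prob_unsat_def bernoulli_config_def
    using Pi_pmf_bernoulli_prob[of "sign_cube N" p "\<lambda>A. satisfying \<kappa> N A = {}"] assms by simp
qed

lemma prob_unsat_strict_mono:
  assumes N: "N > 0" "- \<kappa> < sqrt N" and p: "0 \<le> p" "p < r" "r \<le> 1"
  shows "prob_unsat \<kappa> N p < prob_unsat \<kappa> N r"
proof -
  have "sign_cube N \<noteq> {}" by (simp add: sign_cube_def PiE_eq_empty_iff)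
  have "subset_mean (sign_cube N) p (\<lambda>A. of_bool (satisfying \<kappa> N A = {})) <
      subset_mean (sign_cube N) r (\<lambda>A. of_bool (satisfying \<kappa> N A = {}))"
    using p satisfying_all[OF N] \<open>sign_cube N \<noteq> {}\<close>
    by (intro increasing_event_strict_mono) (auto simp: satisfying_empty satisfying_insert)
  then show ?thesis using p by (simp add: prob_unsat_eq)
qed

text \<open>The intermediate value theorem gives existence and strict monotonicity gives uniqueness,
  so the definite description in \<open>crit_prob\<close> denotes.\<close>

lemma crit_prob_works:
  assumes N: "N > 0" "- \<kappa> < sqrt N" and \<theta>: "0 < \<theta>" "\<theta> < 1"
  shows "0 < crit_prob \<kappa> N \<theta>" "crit_prob \<kappa> N \<theta> < 1" "prob_unsat \<kappa> N (crit_prob \<kappa> N \<theta>) = \<theta>"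
proof -
  let ?g = "\<lambda>p. subset_mean (sign_cube N) p (\<lambda>A. of_bool (satisfying \<kappa> N A = {}))"
  have "sign_cube N \<noteq> {}" by (simp add: sign_cube_def PiE_eq_empty_iff)
  then have 01: "?g 0 = 0" "?g 1 = 1"
    using satisfying_all[OF N] by (simp_all add: subset_mean_at_0 subset_mean_at_1 satisfying_empty)
  have "isCont ?g t" for t
    using subset_mean_has_derivative[OF finite_sign_cube] DERIV_isCont by blast
  then have "\<exists>p. 0 \<le> p \<and> p \<le> 1 \<and> ?g p = \<theta>"
    using 01 \<theta> by (intro IVT) auto
  then obtain p where p: "0 \<le> p" "p \<le> 1" "prob_unsat \<kappa> N p = \<theta>" using prob_unsat_eq by auto
  have "crit_prob \<kappa> N \<theta> = p"
    unfolding crit_prob_def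
  proof (rule the_equality)
    show "r = p" if "r \<in> {0..1} \<and> prob_unsat \<kappa> N r = \<theta>" for r
      using that p prob_unsat_strict_mono[OF N, of r p] prob_unsat_strict_mono[OF N, of p r]
      by (cases r p rule: linorder_cases) auto
  qed (use p in auto)
  moreover have "p \<noteq> 0" "p \<noteq> 1" using p 01 \<theta> prob_unsat_eq[of p \<kappa> N] by auto
  ultimately show "0 < crit_prob \<kappa> N \<theta>" "crit_prob \<kappa> N \<theta> < 1" "prob_unsat \<kappa> N (crit_prob \<kappa> N \<theta>) = \<theta>"
    using p by auto
qed

lemma crit_prob_mono:
  assumes N: "N > 0" "- \<kappa> < sqrt N" and \<theta>: "0 < \<theta>" "\<theta> \<le> \<theta>'" "\<theta>' < 1"
  shows "crit_prob \<kappa> N \<theta> \<le> crit_prob \<kappa> N \<theta>'"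
proof (rule ccontr)
  assume "\<not> ?thesis"
  then have "prob_unsat \<kappa> N (crit_prob \<kappa> N \<theta>') < prob_unsat \<kappa> N (crit_prob \<kappa> N \<theta>)"
    using crit_prob_works[OF N, of \<theta>] crit_prob_works[OF N, of \<theta>'] \<theta>
    by (intro prob_unsat_strict_mono N) auto
  then show False
    using crit_prob_works(3)[OF N, of \<theta>] crit_prob_works(3)[OF N, of \<theta>'] \<theta> by simp
qed

text \<open>Since \<open>ln 0 = 0\<close>, this takes the value \<open>L\<close> on unsatisfiable configurations when \<open>0 \<le> L\<close>.\<close>

definition log_count :: "real \<Rightarrow> nat \<Rightarrow> real \<Rightarrow> (nat \<Rightarrow> real) set \<Rightarrow> real" where
  "log_count \<kappa> N L A = max (ln (card (satisfying \<kappa> N A))) L"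

lemma ln_card_satisfying_le: "ln (real (card (satisfying \<kappa> N A))) \<le> real N * ln 2"
proof (cases "card (satisfying \<kappa> N A) = 0")
  case False
  have "card (satisfying \<kappa> N A) \<le> card (sign_cube N)"
    by (intro card_mono satisfying_subset) simp
  then have "real (card (satisfying \<kappa> N A)) \<le> 2 ^ N"
    by (metis card_sign_cube of_nat_le_iff of_nat_numeral of_nat_power)
  then have "ln (card (satisfying \<kappa> N A)) \<le> ln (2 ^ N)"
    using False by (subst ln_le_cancel_iff) auto
  then show ?thesis by (simp add: ln_realpow)
qed simp

text \<open>The floor \<open>L\<close> bounds the drop: even a constraint removing every solution
  lowers the value by at most \<open>N\<close>, because the logarithm never exceeds
  \<open>N * ln 2\<close>.\<close>

lemma log_count_insert:
  assumes "x \<in> sign_cube N" "0 \<le> L"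
  shows "log_count \<kappa> N L (insert x A) \<le> log_count \<kappa> N L A"
    "log_count \<kappa> N L A - log_count \<kappa> N L (insert x A) \<le> N"
proof -
  let ?a = "card (satisfying \<kappa> N A)" and ?b = "card (satisfying \<kappa> N (insert x A))"
  have le: "?b \<le> ?a" unfolding satisfying_insert[OF assms(1)] by (intro card_mono) auto
  \<comment> \<open>If no solution is left, \<open>ln 0 = 0\<close> and the bound comes from the
    floor.\<close>
  have "ln ?b \<le> max (ln ?a) L"
  proof (cases "?b = 0")
    case False
    then have "0 < ?b" "0 < ?a" using le by linarith+
    then have "ln ?b \<le> ln ?a" using le by (subst ln_le_cancel_iff) linarith+
    then show ?thesis by simp
  qed (use assms in simp)
  then show "log_count \<kappa> N L (insert x A) \<le> log_count \<kappa> N L A" by (simp add: log_count_def)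
  have "real N * ln 2 \<le> real N * 1" using ln_2_less_1 by (intro mult_left_mono) auto
  then have "ln ?a \<le> N" using ln_card_satisfying_le[of \<kappa> N A] by linarith
  then show "log_count \<kappa> N L A - log_count \<kappa> N L (insert x A) \<le> N"
    using assms(2) by (auto simp: log_count_def max_def)
qed

text \<open>With fewer than \<open>exp L\<close> solutions the value already sits at the floor and
  cannot drop. Otherwise \<open>few_destructive_constraints\<close> applies to the solution set:
  typical constraints cost at most \<open>3 * s^2\<close>, the rare others at most \<open>N\<close>.
  The case \<open>k = 1\<close> serves Russo's formula, \<open>k = 2\<close> Efron--Stein.\<close>

lemma sum_log_count_increments:
  fixes k :: nat
  assumes N: "N > 0" and L: "\<eta> * N \<le> L"
    and \<eta>: "0 < \<eta>" "\<eta> \<le> 1" and s: "0 \<le> s" "s \<le> sqrt N / 2"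
    and \<kappa>: "s * \<bar>\<kappa>\<bar> + ln 2 \<le> s\<^sup>2 * \<eta>\<^sup>2 / 288" and k: "k > 0"
  shows "(\<Sum>x\<in>sign_cube N - A. (log_count \<kappa> N L A - log_count \<kappa> N L (insert x A)) ^ k)
    \<le> 2 ^ N * ((3 * s\<^sup>2) ^ k + 2 * exp (- (s\<^sup>2 * \<eta> ^ 4 / 20736)) * N ^ k)"
proof -
  define S where "S = satisfying \<kappa> N A"
  define d where "d = 3 * s\<^sup>2"
  define D where "D x = log_count \<kappa> N L A - log_count \<kappa> N L (insert x A)" for x
  define \<rho> where "\<rho> = 2 * exp (- (s\<^sup>2 * \<eta> ^ 4 / 20736))"
  have L0: "0 \<le> L" using L \<eta> by (intro order_trans[OF _ L]) auto
  have D: "0 \<le> D x" "D x \<le> N" if "x \<in> sign_cube N" for x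
    unfolding D_def using log_count_insert[OF that L0, of \<kappa> A] by auto
  have d0: "0 \<le> d" unfolding d_def by simp
  have "(\<Sum>x\<in>sign_cube N - A. D x ^ k) \<le> 2 ^ N * (d ^ k + \<rho> * real N ^ k)"
  proof (cases "exp L \<le> card S")
    case False
    have "D x = 0" if "x \<in> sign_cube N" for x
    proof -
      have "ln (card S) \<le> L"
      proof (cases "card S = 0")
        case f: False
        then have "ln (card S) \<le> ln (exp L)" using False by (subst ln_le_cancel_iff) auto
        then show ?thesis by simp
      qed (use L0 in simp)
      then have "log_count \<kappa> N L A = L" unfolding log_count_def S_def by simp
      then show ?thesis using D(1)[OF that] unfolding D_def by (simp add: log_count_def)
    qed
    then have "(\<Sum>x\<in>sign_cube N - A. D x ^ k) = 0" using k by (intro sum.neutral) auto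
    also have "0 \<le> 2 ^ N * (d ^ k + \<rho> * real N ^ k)" unfolding \<rho>_def using d0 by simp
    finally show ?thesis .
  next
    case True
    define B where "B = {x \<in> sign_cube N. card (S \<inter> half_cube \<kappa> N x) < exp (- d) * card S}"
    have "exp (\<eta> * N) \<le> card S" using True L by (meson exp_le_cancel_iff order_trans)
    then have B: "card B \<le> \<rho> * 2 ^ N"
      unfolding B_def d_def \<rho>_def using satisfying_subset
      by (intro few_destructive_constraints N \<eta> s \<kappa>) (auto simp: S_def)
    have Spos: "0 < real (card S)" using True exp_gt_zero[of L] by linarith
    have good: "D x \<le> d" if "x \<in> sign_cube N - B" for x
    proof -
      have x: "x \<in> sign_cube N" "exp (- d) * card S \<le> card (S \<inter> half_cube \<kappa> N x)"
        using that unfolding B_def by auto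
      have "ln (exp (- d) * card S) \<le> ln (card (S \<inter> half_cube \<kappa> N x))"
      proof (subst ln_le_cancel_iff)
        show "0 < exp (- d) * card S" using Spos by simp
        then show "0 < real (card (S \<inter> half_cube \<kappa> N x))" using x(2) by linarith
      qed (rule x(2))
      also have "ln (exp (- d) * card S) = - d + ln (card S)"
        using ln_mult[of "exp (- d)" "card S"] Spos by simp
      finally have "ln (card S) - d \<le> ln (card (satisfying \<kappa> N (insert x A)))"
        unfolding satisfying_insert[OF x(1)] S_def by simp
      then show ?thesis
        unfolding D_def log_count_def S_def[symmetric] using d0 by (auto simp: max_def)
    qed
    have "(\<Sum>x\<in>sign_cube N - A. D x ^ k) \<le> (\<Sum>x\<in>sign_cube N. D x ^ k)"
      using D by (intro sum_mono2) auto
    also have "\<dots> \<le> (\<Sum>x\<in>sign_cube N. d ^ k + (if x \<in> B then real N ^ k else 0))"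
    proof (intro sum_mono)
      fix x assume x: "x \<in> sign_cube N"
      show "D x ^ k \<le> d ^ k + (if x \<in> B then real N ^ k else 0)"
      proof (cases "x \<in> B")
        case True
        have "D x ^ k \<le> real N ^ k" using D[OF x] by (intro power_mono) auto
        moreover have "0 \<le> d ^ k" using d0 by simp
        ultimately show ?thesis using True by simp
      next
        case False
        then show ?thesis using good[of x] D[OF x] x by (auto intro: power_mono)
      qed
    qed
    also have "\<dots> = 2 ^ N * d ^ k + card B * real N ^ k"
    proof -
      have inter: "sign_cube N \<inter> B = B" unfolding B_def by auto
      have "(\<Sum>x\<in>sign_cube N. if x \<in> B then real N ^ k else 0) = (\<Sum>x\<in>B. real N ^ k)"
        unfolding sum.inter_restrict[OF finite_sign_cube, symmetric] by (simp only: inter)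
      then show ?thesis by (simp add: sum.distrib)
    qed
    also have "\<dots> \<le> 2 ^ N * d ^ k + (\<rho> * 2 ^ N) * real N ^ k"
      using B by (intro add_left_mono mult_right_mono) auto
    finally show ?thesis by (simp add: algebra_simps)
  qed
  then show ?thesis unfolding D_def d_def \<rho>_def .
qed

text \<open>First moment bound: a solution of \<open>A\<close> survives only if \<open>B\<close>
  contains none of the at least \<open>q * 2 ^ N\<close> constraints excluding it.\<close>

lemma subset_mean_satisfiable_le:
  fixes q :: real
  assumes p: "0 \<le> p" "p \<le> 1" and q: "0 \<le> q"
    and excl: "\<And>y. y \<in> sign_cube N \<Longrightarrow> q * 2 ^ N \<le> real (card {x \<in> sign_cube N. y \<notin> half_cube \<kappa> N x})"
  shows "subset_mean (sign_cube N) p (\<lambda>B. of_bool (satisfying \<kappa> N (A \<union> B) \<noteq> {}))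
    \<le> card (satisfying \<kappa> N A) * exp (- (p * q * 2 ^ N))"
proof -
  let ?E = "\<lambda>y. {x \<in> sign_cube N. y \<notin> half_cube \<kappa> N x}"
  let ?M = "subset_mean (sign_cube N) p"
  have "?M (\<lambda>B. of_bool (satisfying \<kappa> N (A \<union> B) \<noteq> {}))
      \<le> ?M (\<lambda>B. \<Sum>y\<in>satisfying \<kappa> N A. of_bool (B \<inter> ?E y = {}))"
  proof (intro subset_mean_mono p)
    fix B assume B: "B \<subseteq> sign_cube N"
    show "of_bool (satisfying \<kappa> N (A \<union> B) \<noteq> {}) \<le> (\<Sum>y\<in>satisfying \<kappa> N A. of_bool (B \<inter> ?E y = {}) :: real)"
    proof (cases "satisfying \<kappa> N (A \<union> B) = {}")
      case False
      then obtain y where "y \<in> satisfying \<kappa> N A" "B \<inter> ?E y = {}"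
        unfolding satisfying_Un[OF B] by blast
      then have "1 \<le> (\<Sum>y\<in>satisfying \<kappa> N A. of_bool (B \<inter> ?E y = {}) :: real)"
        using member_le_sum[of y "satisfying \<kappa> N A" "\<lambda>y. of_bool (B \<inter> ?E y = {}) :: real"] by simp
      then show ?thesis by simp
    qed (simp add: sum_nonneg)
  qed
  also have "\<dots> = (\<Sum>y\<in>satisfying \<kappa> N A. (1 - p) ^ card (?E y))"
    unfolding subset_mean_sum by (intro sum.cong refl subset_mean_disjoint) auto
  also have "\<dots> \<le> (\<Sum>y\<in>satisfying \<kappa> N A. exp (- (p * q * 2 ^ N)))"
  proof (intro sum_mono)
    fix y assume "y \<in> satisfying \<kappa> N A"
    then have "q * 2 ^ N \<le> real (card (?E y))" using satisfying_subset excl by blast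
    then have 1: "p * (q * 2 ^ N) \<le> p * real (card (?E y))" using p by (intro mult_left_mono) auto
    have "(1 - p) ^ card (?E y) \<le> exp (- p) ^ card (?E y)"
      using p exp_ge_add_one_self[of "- p"] by (intro power_mono) auto
    also have "\<dots> = exp (- (p * card (?E y)))" by (simp add: exp_of_nat_mult[symmetric] mult.commute)
    also have "\<dots> \<le> exp (- (p * q * 2 ^ N))" using 1 by (simp add: mult.assoc)
    finally show "(1 - p) ^ card (?E y) \<le> exp (- (p * q * 2 ^ N))" .
  qed
  finally show ?thesis by simp
qed

section \<open>The sharp threshold\<close>

text \<open>Compares the mean of \<open>log_count\<close> with floor \<open>N / 4\<close> at
  densities 0 and \<open>p\<close>. Unsatisfiable configurations force a drop of at least
  \<open>\<epsilon> * N / 4\<close>, while for densities up to \<open>1 / 2\<close> Russo's formula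
  bounds the downward slope by \<open>2 * 2 ^ N * d\<close>. The constants are those of
  \<open>few_destructive_constraints\<close> at \<open>\<eta> = 1 / 4\<close>.\<close>

lemma mean_number_of_constraints_ge:
  assumes N: "N > 0" and s: "1 \<le> s" "s \<le> sqrt N / 2"
    and \<kappa>: "s * \<bar>\<kappa>\<bar> + ln 2 \<le> s\<^sup>2 / 4608"
    and p: "0 < p" "p < 1"
    and d: "d = 3 * s\<^sup>2 + 2 * exp (- (s\<^sup>2 / 5308416)) * N"
    and \<epsilon>: "prob_unsat \<kappa> N p = \<epsilon>"
  shows "\<epsilon> * N / (8 * d) \<le> p * 2 ^ N"
proof -
  let ?X = "sign_cube N"
  let ?F = "log_count \<kappa> N (N / 4)"
  have \<epsilon>01: "0 \<le> \<epsilon>" "\<epsilon> \<le> 1" unfolding \<epsilon>[symmetric] prob_unsat_def by auto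
  have "3 * 1 \<le> 3 * s\<^sup>2" using s(1) by (intro mult_left_mono one_le_power) auto
  then have d3: "3 \<le> d" unfolding d by (intro add_increasing2) auto
  show ?thesis
  proof (cases "p \<le> 1 / 2")
    case False
    have "\<epsilon> * N / (8 * d) \<le> real N / (8 * 1)"
      using \<epsilon>01 d3 by (intro frac_le mult_left_le_one_le) auto
    also have "\<dots> \<le> 1 / 2 * 2 ^ N"
    proof -
      have "real N < 2 ^ N" by (rule of_nat_less_two_power)
      moreover have "0 \<le> (2::real) ^ N" by simp
      ultimately show ?thesis by linarith
    qed
    also have "\<dots> \<le> p * 2 ^ N" using False by (intro mult_right_mono) auto
    finally show ?thesis .
  next
    case True
    have ln2: "real N * (1 / 2) \<le> real N * ln 2"
      using ln2_ge_two_thirds by (intro mult_left_mono) auto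
    then have "N / 4 \<le> N * ln 2" by linarith
    then have F0: "?F {} = N * ln 2" by (simp add: log_count_def satisfying_empty ln_realpow)
    \<comment> \<open>On unsatisfiable configurations \<open>ln 0 = 0\<close> leaves the floor
      \<open>N / 4\<close>, at least \<open>N / 4\<close> below \<open>N * ln 2\<close> since
      \<open>ln 2 \<ge> 1 / 2\<close>.\<close>
    have Fle: "?F A \<le> N * ln 2 - N / 4 * of_bool (satisfying \<kappa> N A = {})" for A
      using ln2 ln_card_satisfying_le[of \<kappa> N A] by (auto simp: log_count_def)
    have "subset_mean ?X p ?F \<le> subset_mean ?X p (\<lambda>A. N * ln 2 - N / 4 * of_bool (satisfying \<kappa> N A = {}))"
      using p Fle by (intro subset_mean_mono) auto
    also have "\<dots> = N * ln 2 - N / 4 * \<epsilon>"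
      unfolding subset_mean_diff subset_mean_cmult using p \<epsilon> by (simp add: prob_unsat_eq)
    finally have drop: "subset_mean ?X p ?F - subset_mean ?X 0 ?F \<le> - (N / 4 * \<epsilon>)"
      by (simp add: subset_mean_at_0 F0)
    have "\<forall>t. \<exists>D. ((\<lambda>p. subset_mean ?X p ?F) has_real_derivative D) (at t) \<and>
        (1 - t) * D = subset_mean ?X t (\<lambda>A. \<Sum>x\<in>?X - A. ?F (insert x A) - ?F A)"
      using subset_mean_has_derivative[OF finite_sign_cube] by blast
    from choice[OF this] obtain D
      where D: "\<forall>t. ((\<lambda>p. subset_mean ?X p ?F) has_real_derivative D t) (at t) \<and>
        (1 - t) * D t = subset_mean ?X t (\<lambda>A. \<Sum>x\<in>?X - A. ?F (insert x A) - ?F A)" ..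
    have deriv: "((\<lambda>p. subset_mean ?X p ?F) has_real_derivative D t) (at t)" for t
      using D by blast
    obtain t where t: "0 < t" "t < p" "subset_mean ?X p ?F - subset_mean ?X 0 ?F = (p - 0) * D t"
      using MVT2[OF p(1) deriv] by blast
    have "- (2 ^ N * d) = subset_mean ?X t (\<lambda>A. - (2 ^ N * d))" by simp
    also have "\<dots> \<le> subset_mean ?X t (\<lambda>A. \<Sum>x\<in>?X - A. ?F (insert x A) - ?F A)"
    proof (intro subset_mean_mono)
      fix A
      have "(\<Sum>x\<in>?X - A. (?F A - ?F (insert x A)) ^ 1)
          \<le> 2 ^ N * ((3 * s\<^sup>2) ^ 1 + 2 * exp (- (s\<^sup>2 * (1 / 4) ^ 4 / 20736)) * real N ^ 1)"
        using N s \<kappa> by (intro sum_log_count_increments) (auto simp: power2_eq_square)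
      also have "\<dots> = 2 ^ N * d" unfolding d by (simp add: power4_eq_xxxx)
      finally have "(\<Sum>x\<in>?X - A. ?F A - ?F (insert x A)) \<le> 2 ^ N * d" by simp
      then show "- (2 ^ N * d) \<le> (\<Sum>x\<in>?X - A. ?F (insert x A) - ?F A)"
        by (simp add: sum_subtractf)
    qed (use t True in auto)
    also have "\<dots> = (1 - t) * D t" using D by simp
    finally have lower: "(1 - t) * (- D t) \<le> 2 ^ N * d" by simp
    have d0: "0 \<le> 2 ^ N * d" using d3 by simp
    \<comment> \<open>Removing the factor \<open>1 - t \<ge> 1 / 2\<close> of Russo's formula costs
      a factor 2.\<close>
    have "- D t \<le> 2 * (2 ^ N * d)"
    proof (cases "D t < 0")
      case neg: True
      have "1 / 2 * (- D t) \<le> (1 - t) * (- D t)"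
        using t True neg by (intro mult_right_mono) auto
      then show ?thesis using lower by linarith
    next
      case False
      then show ?thesis using d0 by linarith
    qed
    then have "p * (- D t) \<le> p * (2 * (2 ^ N * d))" using p by (intro mult_left_mono) auto
    then have "N / 4 * \<epsilon> \<le> p * (2 * (2 ^ N * d))" using t(3) drop by simp
    then show ?thesis using d3 by (simp add: field_simps)
  qed
qed

text \<open>Separates the probabilistic argument from the asymptotics. The parameters
  \<open>s\<^sub>0\<close> and \<open>d\<close> give the a priori lower bound \<open>M\<close> on
  \<open>p * 2 ^ N\<close>; \<open>s\<close>, \<open>\<eta>\<close> and \<open>v\<close> give the
  variance bound; \<open>large\<close> collects the comparisons of scales.\<close>

lemma sharp_threshold:
  fixes \<kappa> q \<delta> \<epsilon> s\<^sub>0 s \<eta> d v M :: real and N :: nat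
  assumes N: "N > 0" "- \<kappa> < sqrt N"
    and q: "0 < q"
    and excl: "\<And>y. y \<in> sign_cube N \<Longrightarrow> q * 2 ^ N \<le> real (card {x \<in> sign_cube N. y \<notin> half_cube \<kappa> N x})"
    and \<delta>: "0 < \<delta>" "\<delta> \<le> \<epsilon>" and \<epsilon>: "\<epsilon> < 1 / 2"
    and s0: "1 \<le> s\<^sub>0" "s\<^sub>0 \<le> sqrt N / 2" "s\<^sub>0 * \<bar>\<kappa>\<bar> + ln 2 \<le> s\<^sub>0\<^sup>2 / 4608"
    and d: "d = 3 * s\<^sub>0\<^sup>2 + 2 * exp (- (s\<^sub>0\<^sup>2 / 5308416)) * N"
    and s: "0 \<le> s" "s \<le> sqrt N / 2" "s * \<bar>\<kappa>\<bar> + ln 2 \<le> s\<^sup>2 * \<eta>\<^sup>2 / 288"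
    and \<eta>: "0 < \<eta>" "\<eta> \<le> 1"
    and v: "v = (3 * s\<^sup>2)\<^sup>2 + 2 * exp (- (s\<^sup>2 * \<eta> ^ 4 / 20736)) * (real N)\<^sup>2"
    and M: "M = \<delta> * N / (8 * d)"
    and large: "\<eta> * N \<le> \<delta> * q * M / 4" "128 * v < \<delta> ^ 3 * q\<^sup>2 * M" "exp (- (\<delta> * q * M / 2)) \<le> \<delta> / 2"
  shows "crit_prob \<kappa> N (1 - \<epsilon>) \<le> (1 + \<delta>) * crit_prob \<kappa> N \<epsilon>"
proof (rule ccontr)
  define p where "p = crit_prob \<kappa> N \<epsilon>"
  define p' where "p' = crit_prob \<kappa> N (1 - \<epsilon>)"
  assume "\<not> ?thesis"
  then have gap: "\<delta> * p < p' - p" unfolding p_def p'_def by (simp add: algebra_simps)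
  have p: "0 < p" "p < 1" "prob_unsat \<kappa> N p = \<epsilon>"
    unfolding p_def using crit_prob_works[OF N, of \<epsilon>] \<delta> \<epsilon> by auto
  have p': "0 < p'" "p' < 1" "prob_unsat \<kappa> N p' = 1 - \<epsilon>"
    unfolding p'_def using crit_prob_works[OF N, of "1 - \<epsilon>"] \<delta> \<epsilon> by auto
  let ?X = "sign_cube N"
  let ?Z = "\<lambda>A. real (card (satisfying \<kappa> N A))"
  define m where "m = p * 2 ^ N"
  have "0 < s\<^sub>0\<^sup>2" using s0 by simp
  then have dpos: "0 < d" unfolding d by (intro add_pos_nonneg) auto
  have "M \<le> \<epsilon> * N / (8 * d)" unfolding M using \<delta> dpos by (intro divide_right_mono mult_right_mono) auto
  also have "\<dots> \<le> m" unfolding m_def using N(1) s0 p d by (intro mean_number_of_constraints_ge) auto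
  finally have Mm: "M \<le> m" .
  have mpos: "0 < m" unfolding m_def using p by simp
  \<comment> \<open>Beyond \<open>p\<close>, constraints of density at least
    \<open>\<delta> * p\<close> are added, so a fixed solution survives them with probability at
    most \<open>exp (- (4 * L))\<close>.\<close>
  define L where "L = \<delta> * q * m / 4"
  have Lpos: "0 < L" unfolding L_def using \<delta> q mpos by simp
  have "\<delta> * q * M \<le> \<delta> * q * m" using Mm \<delta> q by (intro mult_left_mono) auto
  then have L_ge: "\<delta> * q * M / 4 \<le> L" unfolding L_def by simp
  let ?F = "log_count \<kappa> N L"
  let ?E = "subset_mean ?X p ?F"

  have "variance_of ?X p ?F \<le> p * subset_mean ?X p (\<lambda>A. \<Sum>x\<in>?X - A. (?F (insert x A) - ?F A)\<^sup>2)"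
    using p by (intro efron_stein) auto
  also have "\<dots> \<le> p * subset_mean ?X p (\<lambda>A. 2 ^ N * v)"
  proof (intro mult_left_mono subset_mean_mono)
    fix A
    show "(\<Sum>x\<in>?X - A. (?F (insert x A) - ?F A)\<^sup>2) \<le> 2 ^ N * v"
      unfolding v power2_commute[of "?F (insert _ A)"] using N(1) \<eta> s large(1) L_ge
      by (intro sum_log_count_increments) auto
  qed (use p in auto)
  also have "\<dots> = m * v" unfolding m_def by simp
  finally have variance: "variance_of ?X p ?F \<le> m * v" .
  \<comment> \<open>The aim is \<open>m * v < \<epsilon> * L^2 / 8\<close>, which puts Chebyshev's
    bound at deviation \<open>L / 2\<close> below \<open>\<epsilon> / 2\<close>.\<close>
  have "m * (128 * v) < m * (\<delta> ^ 3 * q\<^sup>2 * M)" using large(2) mpos by (intro mult_strict_left_mono) auto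
  also have "\<dots> \<le> m * (\<delta> ^ 3 * q\<^sup>2 * m)" using Mm mpos \<delta> q by (intro mult_left_mono) auto
  also have "\<dots> = \<delta> * (\<delta> * q * m)\<^sup>2" by (simp add: power2_eq_square power3_eq_cube)
  also have "\<dots> \<le> \<epsilon> * (\<delta> * q * m)\<^sup>2" using \<delta> by (intro mult_right_mono) auto
  also have "\<dots> = 16 * (\<epsilon> * L\<^sup>2)" unfolding L_def by (simp add: power2_eq_square)
  finally have "m * v < \<epsilon> * L\<^sup>2 / 8" by simp
  with variance have "variance_of ?X p ?F < \<epsilon> * L\<^sup>2 / 8" by linarith
  moreover have "subset_mean ?X p (\<lambda>A. of_bool (L / 2 \<le> \<bar>?F A - ?E\<bar>)) \<le> variance_of ?X p ?F / (L / 2)\<^sup>2"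
    using p Lpos by (intro subset_mean_chebyshev) auto
  moreover have "0 < (L / 2)\<^sup>2" using Lpos by simp
  then have "variance_of ?X p ?F / (L / 2)\<^sup>2 < \<epsilon> / 2 \<longleftrightarrow> variance_of ?X p ?F < \<epsilon> * L\<^sup>2 / 8"
    by (simp add: pos_divide_less_eq power_divide mult.commute)
  ultimately have dev: "subset_mean ?X p (\<lambda>A. of_bool (L / 2 \<le> \<bar>?F A - ?E\<bar>)) < \<epsilon> / 2"
    by linarith

  \<comment> \<open>With a mean of at least \<open>3 / 2 * L\<close>, the unsatisfiable
    configurations, of value \<open>L\<close> and probability \<open>\<epsilon>\<close>, would all
    be large deviations, contradicting \<open>dev\<close>. With a smaller mean, every
    \<open>A\<close> having at least \<open>exp (2 * L)\<close> solutions is a large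
    deviation.\<close>
  have rich: "subset_mean ?X p (\<lambda>A. of_bool (exp (2 * L) \<le> ?Z A)) < \<epsilon> / 2"
  proof (cases "3 / 2 * L \<le> ?E")
    case True
    have "\<epsilon> = subset_mean ?X p (\<lambda>A. of_bool (satisfying \<kappa> N A = {}))"
      using p by (simp add: prob_unsat_eq)
    also have "\<dots> \<le> subset_mean ?X p (\<lambda>A. of_bool (L / 2 \<le> \<bar>?F A - ?E\<bar>))"
    proof (intro subset_mean_mono)
      fix A
      have "L / 2 \<le> \<bar>?F A - ?E\<bar>" if "satisfying \<kappa> N A = {}"
      proof -
        have "?F A = L" using that Lpos by (simp add: log_count_def)
        then show ?thesis using True abs_ge_minus_self[of "?F A - ?E"] by linarith
      qed
      then show "of_bool (satisfying \<kappa> N A = {}) \<le> (of_bool (L / 2 \<le> \<bar>?F A - ?E\<bar>) :: real)"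
        by simp
    qed (use p in auto)
    finally show ?thesis using dev \<delta> by simp
  next
    case False
    have "subset_mean ?X p (\<lambda>A. of_bool (exp (2 * L) \<le> ?Z A))
        \<le> subset_mean ?X p (\<lambda>A. of_bool (L / 2 \<le> \<bar>?F A - ?E\<bar>))"
    proof (intro subset_mean_mono)
      fix A
      have "L / 2 \<le> \<bar>?F A - ?E\<bar>" if "exp (2 * L) \<le> ?Z A"
      proof -
        have "0 < ?Z A" using that exp_gt_zero[of "2 * L"] by linarith
        then have "2 * L \<le> ln (?Z A)" using that by (simp add: ln_ge_iff)
        then have "2 * L \<le> ?F A" by (simp add: log_count_def)
        then show ?thesis using False abs_ge_self[of "?F A - ?E"] by linarith
      qed
      then show "of_bool (exp (2 * L) \<le> ?Z A) \<le> (of_bool (L / 2 \<le> \<bar>?F A - ?E\<bar>) :: real)"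
        by simp
    qed (use p in auto)
    then show ?thesis using dev by linarith
  qed

  \<comment> \<open>The density of fresh constraints that lifts \<open>p\<close> to
    \<open>p'\<close> by sprinkling; it is at least \<open>p' - p\<close>.\<close>
  define r where "r = (p' - p) / (1 - p)"
  have "0 < \<delta> * p" using \<delta> p by simp
  then have r: "0 \<le> r" "r \<le> 1" "1 - (1 - p) * (1 - r) = p'"
    unfolding r_def using p p' gap by (auto simp: field_simps)
  have "p' - p \<le> r" unfolding r_def using p gap \<open>0 < \<delta> * p\<close> by (simp add: field_simps mult_left_le)
  then have "\<delta> * p \<le> r" using gap by linarith
  then have "\<delta> * p * (q * 2 ^ N) \<le> r * (q * 2 ^ N)" using q by (intro mult_right_mono) auto
  then have rq: "4 * L \<le> r * q * 2 ^ N" unfolding L_def m_def by (simp add: mult_ac)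
  have "\<epsilon> = 1 - subset_mean ?X p' (\<lambda>A. of_bool (satisfying \<kappa> N A = {}))"
    using p' by (simp add: prob_unsat_eq)
  also have "\<dots> = subset_mean ?X p' (\<lambda>A. 1 - of_bool (satisfying \<kappa> N A = {}))"
    by (simp add: subset_mean_diff)
  also have "\<dots> = subset_mean ?X p' (\<lambda>A. of_bool (satisfying \<kappa> N A \<noteq> {}))"
    by (intro subset_mean_cong) auto
  also have "\<dots> = subset_mean ?X p (\<lambda>A. subset_mean ?X r (\<lambda>B. of_bool (satisfying \<kappa> N (A \<union> B) \<noteq> {})))"
    by (subst subset_mean_sprinkle) (simp_all add: r)
  also have "\<dots> \<le> subset_mean ?X p (\<lambda>A. of_bool (exp (2 * L) \<le> ?Z A) + exp (- (2 * L)))"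
  proof (intro subset_mean_mono)
    fix A
    let ?S = "subset_mean ?X r (\<lambda>B. of_bool (satisfying \<kappa> N (A \<union> B) \<noteq> {}))"
    show "?S \<le> of_bool (exp (2 * L) \<le> ?Z A) + exp (- (2 * L))"
    proof (cases "exp (2 * L) \<le> ?Z A")
      case True
      have "?S \<le> subset_mean ?X r (\<lambda>B. 1)" using r by (intro subset_mean_mono) auto
      then show ?thesis using True by (simp add: add_increasing2)
    next
      case False
      have "?S \<le> ?Z A * exp (- (r * q * 2 ^ N))"
        using r q excl by (intro subset_mean_satisfiable_le) auto
      also have "\<dots> \<le> exp (2 * L) * exp (- (4 * L))"
        using False rq by (intro mult_mono) auto
      also have "\<dots> = exp (- (2 * L))" by (simp add: exp_add[symmetric])
      finally show ?thesis using False by simp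
    qed
  qed (use p in auto)
  also have "\<dots> = subset_mean ?X p (\<lambda>A. of_bool (exp (2 * L) \<le> ?Z A)) + exp (- (2 * L))"
    by (simp add: subset_mean_add)
  also have "\<dots> < \<epsilon> / 2 + \<delta> / 2"
  proof -
    have "exp (- (2 * L)) \<le> exp (- (\<delta> * q * M / 2))" using L_ge by simp
    then show ?thesis using rich large(3) by linarith
  qed
  finally show False using \<delta> by simp
qed

theorem theorem1p1:
  fixes \<kappa> :: real
  shows "\<exists>N\<^sub>0::nat. \<forall>N\<ge>N\<^sub>0. \<forall>\<epsilon>::real.
    ln (ln (real N)) powr (- 1 / 10) \<le> \<epsilon> \<and> \<epsilon> < 1 \<longrightarrow>
    crit_prob \<kappa> N (1 - \<epsilon>) / crit_prob \<kappa> N \<epsilon> \<le> 1 + ln (ln (real N)) powr (- 1 / 10)"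
proof -
  obtain q N\<^sub>1 where q: "0 < q" and excl: "\<And>N y. N \<ge> N\<^sub>1 \<Longrightarrow> y \<in> sign_cube N \<Longrightarrow>
      q * 2 ^ N \<le> real (card {x \<in> sign_cube N. y \<notin> half_cube \<kappa> N x})"
    using excluding_constraints_lower_bound[of \<kappa>] by blast
  \<comment> \<open>Orders of magnitude: \<open>d\<close> is about \<open>N powr (1 / 40)\<close>,
    hence \<open>M\<close> about \<open>\<delta> * N powr (39 / 40)\<close>, which dominates
    \<open>\<eta> * N = N powr (19 / 20)\<close> and \<open>v\<close>, about \<open>sqrt N\<close>;
    \<open>\<delta>\<close> decays more slowly than any power of \<open>N\<close>. Moreover
    \<open>s * \<eta>^2 = N powr (1 / 40)\<close> absorbs \<open>\<kappa>\<close>, and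
    \<open>s^2 * \<eta>^4 = N powr (1 / 20)\<close> makes the exponential term of \<open>v\<close>
    negligible.\<close>
  define \<delta> where "\<delta> N = ln (ln (real N)) powr (- 1 / 10)" for N
  define s\<^sub>0 where "s\<^sub>0 N = real N powr (1 / 80)" for N
  define s where "s N = real N powr (1 / 8)" for N
  define \<eta> where "\<eta> N = real N powr (- 1 / 20)" for N
  define d where "d N = 3 * (s\<^sub>0 N)\<^sup>2 + 2 * exp (- ((s\<^sub>0 N)\<^sup>2 / 5308416)) * real N" for N
  define v where "v N = (3 * (s N)\<^sup>2)\<^sup>2 + 2 * exp (- ((s N)\<^sup>2 * \<eta> N ^ 4 / 20736)) * (real N)\<^sup>2" for N
  define M where "M N = \<delta> N * real N / (8 * d N)" for N
  note defs = M_def v_def d_def \<eta>_def s_def s\<^sub>0_def \<delta>_def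
  have "eventually (\<lambda>N. 0 < \<delta> N) sequentially" unfolding defs by real_asymp
  moreover have "eventually (\<lambda>N. 1 \<le> s\<^sub>0 N \<and> s\<^sub>0 N \<le> sqrt (real N) / 2 \<and> s N \<le> sqrt (real N) / 2) sequentially"
    unfolding defs by (intro eventually_conj; real_asymp)
  moreover have "eventually (\<lambda>N. \<eta> N \<le> 1) sequentially" unfolding defs by real_asymp
  \<comment> \<open>The conditions involving \<open>\<kappa>\<close> and \<open>q\<close> are solved
    for these constants, leaving limits free of them.\<close>
  moreover have "filterlim (\<lambda>N. ((s\<^sub>0 N)\<^sup>2 / 4608 - ln 2) / s\<^sub>0 N) at_top sequentially"
    unfolding defs by real_asymp
  then have "eventually (\<lambda>N. \<bar>\<kappa>\<bar> \<le> ((s\<^sub>0 N)\<^sup>2 / 4608 - ln 2) / s\<^sub>0 N) sequentially"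
    by (simp add: filterlim_at_top)
  moreover have "filterlim (\<lambda>N. ((s N)\<^sup>2 * (\<eta> N)\<^sup>2 / 288 - ln 2) / s N) at_top sequentially"
    unfolding defs by real_asymp
  then have "eventually (\<lambda>N. \<bar>\<kappa>\<bar> \<le> ((s N)\<^sup>2 * (\<eta> N)\<^sup>2 / 288 - ln 2) / s N) sequentially"
    by (simp add: filterlim_at_top)
  moreover have "filterlim (\<lambda>N. \<delta> N * M N / (4 * \<eta> N * real N)) at_top sequentially"
    unfolding defs by real_asymp
  then have "eventually (\<lambda>N. 1 / q \<le> \<delta> N * M N / (4 * \<eta> N * real N)) sequentially"
    by (simp add: filterlim_at_top)
  moreover have "filterlim (\<lambda>N. \<delta> N ^ 3 * M N / (128 * v N)) at_top sequentially"
    unfolding defs by real_asymp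
  then have "eventually (\<lambda>N. 1 / q\<^sup>2 < \<delta> N ^ 3 * M N / (128 * v N)) sequentially"
    by (simp add: filterlim_at_top_dense)
  moreover have "filterlim (\<lambda>N. \<delta> N * M N / 2 / (- ln (\<delta> N / 2))) at_top sequentially"
    unfolding defs by real_asymp
  then have "eventually (\<lambda>N. 1 / q \<le> \<delta> N * M N / 2 / (- ln (\<delta> N / 2))) sequentially"
    by (simp add: filterlim_at_top)
  moreover have "eventually (\<lambda>N. \<delta> N < 1) sequentially" unfolding defs by real_asymp
  moreover have "filterlim (\<lambda>N. sqrt (real N)) at_top sequentially" by real_asymp
  then have "eventually (\<lambda>N. - \<kappa> < sqrt (real N)) sequentially" by (simp add: filterlim_at_top_dense)
  moreover have "eventually (\<lambda>N. N \<ge> N\<^sub>1 \<and> N > 0) sequentially"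
    by (intro eventually_conj eventually_ge_at_top eventually_gt_at_top)
  ultimately have "eventually (\<lambda>N. \<forall>\<epsilon>. \<delta> N \<le> \<epsilon> \<and> \<epsilon> < 1 \<longrightarrow>
      crit_prob \<kappa> N (1 - \<epsilon>) / crit_prob \<kappa> N \<epsilon> \<le> 1 + \<delta> N) sequentially"
  proof eventually_elim
    case (elim N)
    have N: "N > 0" "- \<kappa> < sqrt (real N)" and \<delta>: "0 < \<delta> N" "\<delta> N < 1" using elim by auto
    have pos: "0 < s\<^sub>0 N" "0 < s N" "0 < \<eta> N" using N unfolding defs by auto
    have v: "0 < v N" unfolding v_def using pos N by (intro add_pos_nonneg) auto
    show ?case
    proof (intro allI impI)
      fix \<epsilon> assume \<epsilon>: "\<delta> N \<le> \<epsilon> \<and> \<epsilon> < 1"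
      then have p: "0 < crit_prob \<kappa> N \<epsilon>" using crit_prob_works(1)[OF N] \<delta> by auto
      have "crit_prob \<kappa> N (1 - \<epsilon>) \<le> (1 + \<delta> N) * crit_prob \<kappa> N \<epsilon>"
      proof (cases "\<epsilon> < 1 / 2")
        case True
        show ?thesis
        proof (rule sharp_threshold[OF N q excl])
          show "s\<^sub>0 N * \<bar>\<kappa>\<bar> + ln 2 \<le> (s\<^sub>0 N)\<^sup>2 / 4608" "s N * \<bar>\<kappa>\<bar> + ln 2 \<le> (s N)\<^sup>2 * (\<eta> N)\<^sup>2 / 288"
            using elim pos by (simp_all add: pos_le_divide_eq mult.commute)
          show "\<eta> N * real N \<le> \<delta> N * q * M N / 4"
            using elim pos q N by (simp add: field_simps)
          show "128 * v N < \<delta> N ^ 3 * q\<^sup>2 * M N"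
            using elim v q by (simp add: field_simps)
          have "0 < - ln (\<delta> N / 2)" using \<delta> by simp
          then have "- ln (\<delta> N / 2) \<le> \<delta> N * q * M N / 2" using elim q by (simp add: field_simps)
          then have "exp (- (\<delta> N * q * M N / 2)) \<le> exp (ln (\<delta> N / 2))" by simp
          then show "exp (- (\<delta> N * q * M N / 2)) \<le> \<delta> N / 2" using \<delta> by simp
        qed (use elim \<epsilon> True pos in \<open>auto simp: d_def v_def M_def\<close>)
      next
        \<comment> \<open>For \<open>\<epsilon> \<ge> 1 / 2\<close> monotonicity suffices, as
          \<open>1 - \<epsilon> \<le> \<epsilon>\<close>.\<close>
        case False
        then have "crit_prob \<kappa> N (1 - \<epsilon>) \<le> crit_prob \<kappa> N \<epsilon>"
          using \<epsilon> by (intro crit_prob_mono N) auto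
        also have "\<dots> \<le> (1 + \<delta> N) * crit_prob \<kappa> N \<epsilon>" using p \<delta> by simp
        finally show ?thesis .
      qed
      then show "crit_prob \<kappa> N (1 - \<epsilon>) / crit_prob \<kappa> N \<epsilon> \<le> 1 + \<delta> N"
        using p by (simp add: field_simps)
    qed
  qed
  then show ?thesis unfolding \<delta>_def eventually_sequentially .
qed

end
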